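(* Let $\sigma\in\mathbb R^+\setminus\mathbb Q$ have simple continued fraction expansion $[c_0,c_1,\ldots]$, let $k_1\ge 0$ be an integer, and let $$(k_i)_{i=1}^\infty=(k_1,c_0,\underbrace{0,\ldots,0}_{c_1-1},c_2,\underbrace{0,\ldots,0}_{c_3-1},c_4,\underbrace{0,\ldots,0}_{c_5-1},c_6,\ldots).$$ Let $\Lambda$ be the category of paths associated to $(k_i)$ and $G$ the associated groupoid. If there exists an invariant Borel probability measure on $G^{(0)}$, then it is unique.
   Context: Category $\Lambda$. Given nonnegative integers $k_1,k_2,\ldots$ with $k_i>0$ for infinitely many $i$, $\Lambda$ is the small category with units (objects) $v_1,v_2,\ldots$, generated by edges $\alpha_i$, $\beta_i$, $\gamma_i^{(j)}$ ($i\ge1$, $1\le j\le k_i$), each having range $v_i$ and source $v_{i+1}$, subject only to the relations $\alpha_i\beta_{i+1}=\beta_i\alpha_{i+1}$ for all $i\ge1$. A product $\mu\nu$ is defined iff $s(\mu)=r(\nu)$; $v\Lambda=\{\lambda: r(\lambda)=v\}$. Directed hereditary sets. $[\nu]=\{\mu\in\Lambda:\nu\in\mu\Lambda\}$ where $\mu\Lambda=\{\mu\eta:r(\eta)=s(\mu)\}$. A subset $x\subseteq\Lambda$ is directed if $x\cap\mu\Lambda\cap\nu\Lambda\ne\varnothing$ for all $\mu,\nu\in x$, and hereditary if $[\mu]\subseteq x$ for all $\mu\in x$. $\Lambda^*$ is the set of nonempty directed hereditary subsets; all elements of $x\in\Lambda^*$ have the same range $r(x)$. $Z(\mu)=\{x\in\Lambda^*:\mu\in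 x\}$. $\Lambda^*$ has the locally compact Hausdorff topology with base $\{Z(\lambda)\setminus\bigcup_{i=1}^kZ(\mu_i)\}$. $\Lambda^{**}$ is the set of maximal elements of $\Lambda^*$ under inclusion, $\partial\Lambda=\overline{\Lambda^{**}}$, $v\partial\Lambda=\{x\in\partial\Lambda:r(x)=v\}$. For $r(x)=s(\mu)$, $\mu x=\bigcup_{\nu\in x}[\mu\nu]$. Groupoid $G$. Put $X=v_1\partial\Lambda$. $G$ is the set of equivalence classes $[\mu,\nu,x]$ of triples with $\mu,\nu\in v_1\Lambda$, $s(\mu)=s(\nu)$, $x\in s(\mu)\partial\Lambda$, for the equivalence relation generated by $(\mu,\nu,\eta x)\sim(\mu\eta,\nu\eta,x)$, with $s([\mu,\nu,x])=\nu x$, $r([\mu,\nu,x])=\mu x$, $[\mu,\nu,x]^{-1}=[\nu,\mu,x]$, $[\mu,\nu,x][\nu,\eta,x]=[\mu,\eta,x]$. Its unit space $G^{(0)}$ is identified with $X$ (compact), and the sets $[\mu,\nu,E]=\{[\mu,\nu,x]:x\in E\}$, $E\subseteq s(\mu)\partial\Lambda$ compact open, form a base of its topology; $G$ is an ample Hausdorff étale groupoid. A measure $\mu$ on the unit space of an étale groupoid $\Gamma$ is invariant if $\mu(s(E))=\mu(r(E))$ for every open bisection $E\subseteq\Gamma$. The continued fraction is simple if $c_0\in\mathbb Z$ and $c_i$ is a positive integer for $i\ge1$. *)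

theory Defs
  imports "HOL-Probability.Probability"
begin

section \<open>The category of paths\<close>

text \<open>
  The object \<open>v\<^sub>i\<close> is represented by its index \<open>i \<ge> 1\<close>.  The parameters \<open>k\<^sub>1, k\<^sub>2, \<dots>\<close> are
  \<open>k 1, k 2, \<dots>\<close>; the value \<open>k 0\<close> is never used.  \<open>Gamma i j\<close> stands for the edge \<open>\<gamma>\<^sub>i\<^sup>(\<^sup>j\<^sup>)\<close>.
\<close>

datatype edge = Alpha nat | Beta nat | Gamma nat nat

fun edge_rng :: "edge \<Rightarrow> nat" where
  "edge_rng (Alpha i) = i"
| "edge_rng (Beta i) = i"
| "edge_rng (Gamma i j) = i"

definition edge_src :: "edge \<Rightarrow> nat" where
  "edge_src e = Suc (edge_rng e)"

definition edges :: "(nat \<Rightarrow> nat) \<Rightarrow> edge set" where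
  "edges k = {Alpha i |i. i \<ge> 1} \<union> {Beta i |i. i \<ge> 1}
           \<union> {Gamma i j |i j. i \<ge> 1 \<and> 1 \<le> j \<and> j \<le> k i}"

text \<open>
  A morphism of the free category on the edges is a pair \<open>(i, es)\<close> of its range and its list of
  composable edges; the range is recorded separately because of the identities \<open>(i, [])\<close>.
\<close>

type_synonym word = "nat \<times> edge list"

fun composable :: "(nat \<Rightarrow> nat) \<Rightarrow> nat \<Rightarrow> edge list \<Rightarrow> bool" where
  "composable k i [] \<longleftrightarrow> i \<ge> 1"
| "composable k i (e # es) \<longleftrightarrow> e \<in> edges k \<and> edge_rng e = i \<and> composable k (edge_src e) es"

definition words :: "(nat \<Rightarrow> nat) \<Rightarrow> word set" where
  "words k = {(i, es). composable k i es}"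

definition word_src :: "word \<Rightarrow> nat" where
  "word_src w = (if snd w = [] then fst w else edge_src (last (snd w)))"

text \<open>
  The congruence on the free category generated by
  \<open>\<alpha>\<^sub>i\<beta>\<^sub>i\<^sub>+\<^sub>1 = \<beta>\<^sub>i\<alpha>\<^sub>i\<^sub>+\<^sub>1\<close>: the equivalence relation generated by
  applying one of these relations inside a word.
\<close>

definition swap_step :: "(nat \<Rightarrow> nat) \<Rightarrow> (word \<times> word) set" where
  "swap_step k =
     {((n, us @ [Alpha i, Beta (Suc i)] @ vs), (n, us @ [Beta i, Alpha (Suc i)] @ vs)) |n us i vs.
        (n, us @ [Alpha i, Beta (Suc i)] @ vs) \<in> words k}"

definition word_cong :: "(nat \<Rightarrow> nat) \<Rightarrow> (word \<times> word) set" where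
  "word_cong k = (swap_step k \<union> (swap_step k)\<inverse>)\<^sup>* \<inter> words k \<times> words k"

type_synonym mor = "word set"

definition Lam :: "(nat \<Rightarrow> nat) \<Rightarrow> mor set" where
  "Lam k = words k // word_cong k"

text \<open>
  Range, source and product of classes are computed on representatives; here as below,
  \<open>the_elem\<close> picks the common value on all representatives.  The product
  \<open>mor_comp k \<mu> \<nu>\<close> is meaningful only if \<open>mor_src \<mu> = mor_rng \<nu>\<close>.
\<close>

definition mor_rng :: "mor \<Rightarrow> nat" where
  "mor_rng \<mu> = the_elem (fst ` \<mu>)"

definition mor_src :: "mor \<Rightarrow> nat" where
  "mor_src \<mu> = the_elem (word_src ` \<mu>)"

definition mor_comp :: "(nat \<Rightarrow> nat) \<Rightarrow> mor \<Rightarrow> mor \<Rightarrow> mor" where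
  "mor_comp k \<mu> \<nu> = (\<Union>p\<in>\<mu>. \<Union>q\<in>\<nu>. word_cong k `` {(fst p, snd p @ snd q)})"

definition Lam_at :: "(nat \<Rightarrow> nat) \<Rightarrow> nat \<Rightarrow> mor set" where
  "Lam_at k v = {\<mu> \<in> Lam k. mor_rng \<mu> = v}"

section \<open>Directed hereditary sets\<close>

definition extensions :: "(nat \<Rightarrow> nat) \<Rightarrow> mor \<Rightarrow> mor set" where
  "extensions k \<mu> = {mor_comp k \<mu> \<eta> |\<eta>. \<eta> \<in> Lam k \<and> mor_rng \<eta> = mor_src \<mu>}"

definition prefixes_of :: "(nat \<Rightarrow> nat) \<Rightarrow> mor \<Rightarrow> mor set" where
  "prefixes_of k \<nu> = {\<mu> \<in> Lam k. \<nu> \<in> extensions k \<mu>}"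

definition directed :: "(nat \<Rightarrow> nat) \<Rightarrow> mor set \<Rightarrow> bool" where
  "directed k x \<longleftrightarrow> (\<forall>\<mu>\<in>x. \<forall>\<nu>\<in>x. x \<inter> extensions k \<mu> \<inter> extensions k \<nu> \<noteq> {})"

definition hereditary :: "(nat \<Rightarrow> nat) \<Rightarrow> mor set \<Rightarrow> bool" where
  "hereditary k x \<longleftrightarrow> (\<forall>\<mu>\<in>x. prefixes_of k \<mu> \<subseteq> x)"

definition Lam_star :: "(nat \<Rightarrow> nat) \<Rightarrow> mor set set" where
  "Lam_star k = {x. x \<subseteq> Lam k \<and> x \<noteq> {} \<and> directed k x \<and> hereditary k x}"

definition set_rng :: "mor set \<Rightarrow> nat" where
  "set_rng x = the_elem (mor_rng ` x)"

definition Z :: "(nat \<Rightarrow> nat) \<Rightarrow> mor \<Rightarrow> mor set set" where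
  "Z k \<mu> = {x \<in> Lam_star k. \<mu> \<in> x}"

text \<open>
  The generating sets are a base of the generated topology: if \<open>x\<close> lies in \<open>Z k \<kappa> \<inter> Z k \<mu>\<close>, then
  \<open>x\<close> contains some common extension \<open>\<nu>\<close> of \<open>\<kappa>\<close> and \<open>\<mu>\<close> by directedness, and
  \<open>x \<in> Z k \<nu> \<subseteq> Z k \<kappa> \<inter> Z k \<mu>\<close> by heredity.
\<close>

definition Lam_star_top :: "(nat \<Rightarrow> nat) \<Rightarrow> mor set topology" where
  "Lam_star_top k =
     topology_generated_by {Z k \<kappa> - (\<Union>\<mu>\<in>F. Z k \<mu>) |\<kappa> F. \<kappa> \<in> Lam k \<and> finite F \<and> F \<subseteq> Lam k}"

definition Lam_max :: "(nat \<Rightarrow> nat) \<Rightarrow> mor set set" where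
  "Lam_max k = {x \<in> Lam_star k. \<forall>y\<in>Lam_star k. x \<subseteq> y \<longrightarrow> y = x}"

definition bdry :: "(nat \<Rightarrow> nat) \<Rightarrow> mor set set" where
  "bdry k = Lam_star_top k closure_of Lam_max k"

definition bdry_at :: "(nat \<Rightarrow> nat) \<Rightarrow> nat \<Rightarrow> mor set set" where
  "bdry_at k v = {x \<in> bdry k. set_rng x = v}"

definition shift :: "(nat \<Rightarrow> nat) \<Rightarrow> mor \<Rightarrow> mor set \<Rightarrow> mor set" where
  "shift k \<mu> x = (\<Union>\<nu>\<in>x. prefixes_of k (mor_comp k \<mu> \<nu>))"

section \<open>Groupoids and invariant measures\<close>

text \<open>
  The set of arrows of \<open>\<Gamma>\<close> is \<open>topspace (arrows \<Gamma>)\<close>.  The unit space is allowed to be a separate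
  topological space, identified with the set of unit arrows.
\<close>

record ('g, 'u) top_groupoid =
  arrows :: "'g topology"
  units :: "'u topology"
  gsrc :: "'g \<Rightarrow> 'u"
  grng :: "'g \<Rightarrow> 'u"
  ginv :: "'g \<Rightarrow> 'g"
  gmult :: "'g \<Rightarrow> 'g \<Rightarrow> 'g"

definition open_bisection :: "('g, 'u) top_groupoid \<Rightarrow> 'g set \<Rightarrow> bool" where
  "open_bisection \<Gamma> E \<longleftrightarrow>
     openin (arrows \<Gamma>) E \<and> inj_on (gsrc \<Gamma>) E \<and> inj_on (grng \<Gamma>) E"

definition borel_measure_on :: "'a topology \<Rightarrow> 'a measure \<Rightarrow> bool" where
  "borel_measure_on T M \<longleftrightarrow>
     space M = topspace T \<and> sets M = sigma_sets (topspace T) {U. openin T U}"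

definition invariant_measure :: "('g, 'u) top_groupoid \<Rightarrow> 'u measure \<Rightarrow> bool" where
  "invariant_measure \<Gamma> M \<longleftrightarrow>
     (\<forall>E. open_bisection \<Gamma> E \<longrightarrow> emeasure M (gsrc \<Gamma> ` E) = emeasure M (grng \<Gamma> ` E))"

definition invariant_borel_prob :: "('g, 'u) top_groupoid \<Rightarrow> 'u measure \<Rightarrow> bool" where
  "invariant_borel_prob \<Gamma> M \<longleftrightarrow>
     borel_measure_on (units \<Gamma>) M \<and> prob_space M \<and> invariant_measure \<Gamma> M"

section \<open>The groupoid of the category of paths\<close>

type_synonym triple = "mor \<times> mor \<times> mor set"

definition triples :: "(nat \<Rightarrow> nat) \<Rightarrow> triple set" where
  "triples k = {(\<mu>, \<nu>, x). \<mu> \<in> Lam_at k 1 \<and> \<nu> \<in> Lam_at k 1 \<and> mor_src \<mu> = mor_src \<nu>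
                         \<and> x \<in> bdry_at k (mor_src \<mu>)}"

definition triple_step :: "(nat \<Rightarrow> nat) \<Rightarrow> (triple \<times> triple) set" where
  "triple_step k =
     {((\<mu>, \<nu>, shift k \<eta> x), (mor_comp k \<mu> \<eta>, mor_comp k \<nu> \<eta>, x)) |\<mu> \<nu> \<eta> x.
        \<mu> \<in> Lam_at k 1 \<and> \<nu> \<in> Lam_at k 1 \<and> mor_src \<mu> = mor_src \<nu> \<and>
        \<eta> \<in> Lam_at k (mor_src \<mu>) \<and> x \<in> bdry_at k (mor_src \<eta>)}"

definition triple_equiv :: "(nat \<Rightarrow> nat) \<Rightarrow> (triple \<times> triple) set" where
  "triple_equiv k = (triple_step k \<union> (triple_step k)\<inverse>)\<^sup>* \<inter> triples k \<times> triples k"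

type_synonym arrow = "triple set"

definition arrow_of :: "(nat \<Rightarrow> nat) \<Rightarrow> mor \<Rightarrow> mor \<Rightarrow> mor set \<Rightarrow> arrow" where
  "arrow_of k \<mu> \<nu> x = triple_equiv k `` {(\<mu>, \<nu>, x)}"

definition unit_space :: "(nat \<Rightarrow> nat) \<Rightarrow> mor set topology" where
  "unit_space k = subtopology (Lam_star_top k) (bdry_at k 1)"

definition arrow_top :: "(nat \<Rightarrow> nat) \<Rightarrow> arrow topology" where
  "arrow_top k =
     topology_generated_by
       {arrow_of k \<mu> \<nu> ` E |\<mu> \<nu> E.
          \<mu> \<in> Lam_at k 1 \<and> \<nu> \<in> Lam_at k 1 \<and> mor_src \<mu> = mor_src \<nu> \<and>
          openin (subtopology (Lam_star_top k) (bdry_at k (mor_src \<mu>))) E \<and>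
          compactin (Lam_star_top k) E}"

text \<open>As before, the structure maps are computed on representatives, and the product is
  meaningful only for arrows \<open>g\<close>, \<open>h\<close> such that the source of \<open>g\<close> is the range of \<open>h\<close>.\<close>

definition path_groupoid :: "(nat \<Rightarrow> nat) \<Rightarrow> (arrow, mor set) top_groupoid" where
  "path_groupoid k =
     \<lparr> arrows = arrow_top k,
       units = unit_space k,
       gsrc = (\<lambda>g. the_elem ((\<lambda>(\<mu>, \<nu>, x). shift k \<nu> x) ` g)),
       grng = (\<lambda>g. the_elem ((\<lambda>(\<mu>, \<nu>, x). shift k \<mu> x) ` g)),
       ginv = (\<lambda>g. (\<lambda>(\<mu>, \<nu>, x). (\<nu>, \<mu>, x)) ` g),
       gmult = (\<lambda>g h. \<Union> {arrow_of k \<mu> \<eta> x |\<mu> \<nu> \<eta> x. (\<mu>, \<nu>, x) \<in> g \<and> (\<nu>, \<eta>, x) \<in> h}) \<rparr>"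

section \<open>Continued fractions and the sequence of multiplicities\<close>

text \<open>\<open>cf_convergent c n\<close> is the finite continued fraction \<open>[c\<^sub>0, \<dots>, c\<^sub>n]\<close>.\<close>

fun cf_convergent :: "(nat \<Rightarrow> int) \<Rightarrow> nat \<Rightarrow> real" where
  "cf_convergent c 0 = of_int (c 0)"
| "cf_convergent c (Suc n) = of_int (c 0) + 1 / cf_convergent (\<lambda>i. c (Suc i)) n"

definition simple_cf_expansion :: "real \<Rightarrow> (nat \<Rightarrow> int) \<Rightarrow> bool" where
  "simple_cf_expansion \<sigma> c \<longleftrightarrow> (\<forall>i\<ge>1. c i > 0) \<and> cf_convergent c \<longlonglongrightarrow> \<sigma>"

text \<open>
  The sequence \<open>(k\<^sub>1, c\<^sub>0, 0, \<dots>, 0, c\<^sub>2, 0, \<dots>, 0, c\<^sub>4, \<dots>)\<close> is \<open>k\<^sub>1\<close> followed by the blocks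
  \<open>c\<^sub>2\<^sub>m, 0, \<dots>, 0\<close> with \<open>c\<^sub>2\<^sub>m\<^sub>+\<^sub>1 - 1\<close> zeros.  It is indexed from 1, and its \<open>i\<close>-th entry lies
  in the prefix made up of \<open>k\<^sub>1\<close> and the first \<open>i\<close> blocks, since no block is empty.
\<close>

definition cf_block :: "(nat \<Rightarrow> int) \<Rightarrow> nat \<Rightarrow> nat list" where
  "cf_block c m = nat (c (2 * m)) # replicate (nat (c (2 * m + 1) - 1)) 0"

definition mult_seq :: "nat \<Rightarrow> (nat \<Rightarrow> int) \<Rightarrow> nat \<Rightarrow> nat" where
  "mult_seq k1 c i = (k1 # concat (map (cf_block c) [0..<i])) ! (i - 1)"

end

(*
  For an invariant probability measure M, invariance under the bisections [\<mu>, \<nu>, E] forces the mass of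
  the cylinder Z(\<mu>) \<inter> X to depend only on the index n of s(\<mu>) = v_n; call it m_n.  Every boundary point
  containing \<mu> contains a one-edge extension of \<mu>, and \<alpha>_n and \<beta>_n have the least common multiple
  \<alpha>_n\<beta>_{n+1}, so m_n = (2 + k_n) m_{n+1} - m_{n+2} with m_1 = 1.  The difference of two solutions is
  zero at 1 and, unless it vanishes, grows at least linearly in absolute value, whereas all m_n lie in
  [0, 1]; hence the m_n are determined.  The cylinders form a countable \<pi>-system generating the Borel
  sets, because \<Lambda> is countable and least common multiples exist in it.
*)
theory Submission
  imports Defs
begin

text \<open>Two obstacles shape the proof. Morphisms are congruence classes of words, so
  cancellation and least common multiples have to be extracted from the relations
  \<open>\<alpha>\<^sub>i\<beta>\<^sub>i\<^sub>+\<^sub>1 =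
  \<beta>\<^sub>i\<alpha>\<^sub>i\<^sub>+\<^sub>1\<close>; a normal form that decides the congruence
  turns both into statements about lists. Moreover, [\<mu>, \<nu>, E] is a basic open set of the
  groupoid only for compact open E, while the argument takes E to be all boundary points at
  s(\<mu>): hence the compactness proof. That this bisection has source Z(\<nu>) \<inter> X and
  range Z(\<mu>) \<inter> X rests on shifts and their inverses being continuous and preserving
  maximality, so that they preserve the closure of the maximal sets.

  A second-order recurrence needs two initial values, but only m_1 is known; boundedness replaces
  the second. The linear growth comes from the coefficient 2 + k_n \<ge> 2, which makes a positive
  solution convex.\<close>

section \<open>Normal forms of words\<close>

text \<open>
  The normal form of a word moves, within each maximal run of \<open>\<alpha>\<close>- and \<open>\<beta>\<close>-edges, all \<open>\<alpha>\<close>'s to the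
  front; the indices stay attached to the positions.
\<close>

fun ins :: "edge \<Rightarrow> edge list \<Rightarrow> edge list" where
  "ins e [] = [e]"
| "ins e (f # es) =
     (case (e, f) of (Beta i, Alpha j) \<Rightarrow> Alpha i # ins (Beta j) es | _ \<Rightarrow> e # f # es)"

definition nf :: "edge list \<Rightarrow> edge list" where
  "nf es = foldr ins es []"

lemma nf_Nil [simp]: "nf [] = []"
  and nf_Cons [simp]: "nf (e # es) = ins e (nf es)"
  by (simp_all add: nf_def)

lemma nf_append: "nf (us @ vs) = foldr ins us (nf vs)"
  by (simp add: nf_def)

lemma ins_Alpha [simp]: "ins (Alpha i) es = Alpha i # es"
  and ins_Gamma [simp]: "ins (Gamma i j) es = Gamma i j # es"
  by (cases es; simp)+

lemma length_ins [simp]: "length (ins e es) = Suc (length es)"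
  by (induction e es rule: ins.induct) (auto split: edge.splits)

lemma length_nf [simp]: "length (nf es) = length es"
  by (induction es) auto

text \<open>Insertion only rewrites a \<open>Beta\<close> standing before an \<open>Alpha\<close>,
  and there both sides unfold to the same \<open>Alpha\<close> in front of an insertion into the
  tail. Normalising a front segment in advance is therefore harmless, which makes equality of normal
  forms a congruence for \<open>@\<close>, on arbitrary lists.\<close>

lemma nf_ins_append: "nf (ins e es @ vs) = ins e (nf (es @ vs))"
  by (induction e es rule: ins.induct) (auto split: edge.splits)

lemma nf_nf_append: "nf (nf es @ vs) = nf (es @ vs)"
  by (induction es) (auto simp: nf_ins_append)

lemma nf_nf [simp]: "nf (nf es) = nf es"
  using nf_nf_append[of es "[]"] by simp

lemma nf_append_cong:
  assumes "nf us = nf us'" "nf vs = nf vs'"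
  shows "nf (us @ vs) = nf (us' @ vs')"
  by (metis assms nf_append nf_nf_append)

text \<open>A swap hands the index of the \<open>Alpha\<close> on to the \<open>Beta\<close>
  inserted next, so equality of indices belongs to the induction claim: it recovers the letter that
  was moved.\<close>

lemma ins_Beta_inject: "ins (Beta i) es = ins (Beta j) fs \<Longrightarrow> i = j \<and> es = fs"
proof (induction es arbitrary: i j fs)
  case Nil
  then show ?case by (cases fs) (auto split: edge.splits)
next
  case (Cons e es)
  then show ?case by (cases fs; cases e) (auto split: edge.splits)
qed

lemma ins_inject: "ins e es = ins e fs \<Longrightarrow> es = fs"
  by (cases e) (auto dest: ins_Beta_inject)

text \<open>Each prepended letter acts injectively on normal forms. This is left cancellation in
  \<Lambda>, on which divisibility, the inversion of shifts and the injectivity of bisections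
  rest.\<close>

lemma nf_append_cancel: "nf (us @ vs) = nf (us @ ws) \<Longrightarrow> nf vs = nf ws"
  by (induction us) (auto dest: ins_inject)

section \<open>Composable words and their sources\<close>

lemma edge_src_simps [simp]:
  "edge_src (Alpha i) = Suc i" "edge_src (Beta i) = Suc i" "edge_src (Gamma i j) = Suc i"
  by (simp_all add: edge_src_def)

lemma edges_simps [simp]:
  "Alpha i \<in> edges k \<longleftrightarrow> i \<ge> 1" "Beta i \<in> edges k \<longleftrightarrow> i \<ge> 1"
  "Gamma i j \<in> edges k \<longleftrightarrow> i \<ge> 1 \<and> 1 \<le> j \<and> j \<le> k i"
  by (auto simp: edges_def)

lemma composable_pos: "composable k i es \<Longrightarrow> i \<ge> 1"
  by (cases es) (auto simp: edges_def)

lemma composable_append: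
  "composable k i (es @ fs) \<longleftrightarrow> composable k i es \<and> composable k (i + length es) fs"
  by (induction es arbitrary: i) (auto simp: edge_src_def dest: composable_pos)

text \<open>A swap leaves the indices at their positions, and \<open>Alpha\<close> and
  \<open>Beta\<close> edges exist at the same indices.\<close>

lemma composable_ins: "composable k i (ins e es) \<longleftrightarrow> composable k i (e # es)"
proof (induction e es arbitrary: i rule: ins.induct)
  case (2 e f es)
  show ?case
  proof (cases "\<exists>n m. e = Beta n \<and> f = Alpha m")
    case True
    then obtain n m where ef: "e = Beta n" "f = Alpha m" by blast
    have "composable k (Suc i) (ins (Beta m) es) \<longleftrightarrow> composable k (Suc i) (Beta m # es)"
      using 2 ef by blast
    then show ?thesis unfolding ef by auto
  next
    case False
    then have "ins e (f # es) = e # f # es" by (auto split: edge.splits)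
    then show ?thesis by simp
  qed
qed simp

lemma composable_nf [simp]: "composable k i (nf es) \<longleftrightarrow> composable k i es"
  by (induction es arbitrary: i) (auto simp: composable_ins)

lemma composable_cong: "nf us = nf vs \<Longrightarrow> composable k i us \<longleftrightarrow> composable k i vs"
  by (metis composable_nf)

lemma word_src_eq: "composable k i es \<Longrightarrow> word_src (i, es) = i + length es"
proof (induction es arbitrary: i)
  case (Cons e es)
  then have "word_src (Suc i, es) = Suc i + length es" "i = edge_rng e" by (auto simp: edge_src_def)
  then show ?case by (auto simp: word_src_def edge_src_def)
qed (simp add: word_src_def)

section \<open>The normal form decides the congruence\<close>

abbreviation swaps :: "(nat \<Rightarrow> nat) \<Rightarrow> (word \<times> word) set" where
  "swaps k \<equiv> (swap_step k \<union> (swap_step k)\<inverse>)\<^sup>*"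

lemma swap_step_nf:
  assumes "(v, w) \<in> swap_step k"
  shows "fst v = fst w \<and> nf (snd v) = nf (snd w)"
  using assms by (auto simp: swap_step_def nf_append)

lemma swaps_nf:
  assumes "(v, w) \<in> swaps k"
  shows "fst v = fst w \<and> nf (snd v) = nf (snd w)"
  using assms by (induction rule: rtrancl_induct) (auto dest!: swap_step_nf)

lemma swap_step_Cons:
  assumes "((i, es), (j, fs)) \<in> swap_step k" "e \<in> edges k" "edge_src e = i"
  shows "((edge_rng e, e # es), (edge_rng e, e # fs)) \<in> swap_step k"
proof -
  obtain us n vs where "i = j" "es = us @ [Alpha n, Beta (Suc n)] @ vs"
      "fs = us @ [Beta n, Alpha (Suc n)] @ vs" "composable k i es"
    using assms(1) by (auto simp: swap_step_def words_def)
  moreover from this have "(edge_rng e, (e # us) @ [Alpha n, Beta (Suc n)] @ vs) \<in> words k"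
    using assms(2,3) by (simp add: words_def)
  ultimately show ?thesis
    unfolding swap_step_def mem_Collect_eq
    by (intro exI[of _ "edge_rng e"] exI[of _ "e # us"] exI[of _ n] exI[of _ vs]) simp
qed

lemma swaps_Cons:
  assumes "((i, es), (j, fs)) \<in> swaps k" "e \<in> edges k" "edge_src e = i"
  shows "((edge_rng e, e # es), (edge_rng e, e # fs)) \<in> swaps k"
  using assms(1)
proof (induction "(j, fs)" arbitrary: j fs rule: rtrancl_induct)
  case (step w)
  obtain j' gs where w: "w = (j', gs)" by fastforce
  have [simp]: "j' = i" "j = i"
    using swaps_nf[OF step(1)] swaps_nf[OF rtrancl.rtrancl_into_rtrancl[OF step(1,2)]] w by auto
  have "((edge_rng e, e # gs), (edge_rng e, e # fs)) \<in> swap_step k \<union> (swap_step k)\<inverse>"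
    using step(2) w assms(2,3) swap_step_Cons by auto
  with step(3)[OF w] show ?case by (meson rtrancl.rtrancl_into_rtrancl)
qed auto

text \<open>Each pass of a \<open>Beta\<close> over an \<open>Alpha\<close> is one reversed
  \<open>swap_step\<close>; composability makes the two indices consecutive, as the relation
  requires.\<close>

lemma swaps_ins: "composable k i (e # es) \<Longrightarrow> ((i, e # es), (i, ins e es)) \<in> swaps k"
proof (induction e es arbitrary: i rule: ins.induct)
  case (2 e f es)
  show ?case
  proof (cases "\<exists>n m. e = Beta n \<and> f = Alpha m")
    case True
    with 2(2) have ef: "e = Beta i" "f = Alpha (Suc i)" "i \<ge> 1" "composable k (Suc (Suc i)) es"
      by auto
    have "((i, [] @ [Alpha i, Beta (Suc i)] @ es), (i, [] @ [Beta i, Alpha (Suc i)] @ es)) \<in> swap_step k"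
      unfolding swap_step_def mem_Collect_eq
      by (intro exI conjI, rule refl) (use ef in \<open>simp add: words_def\<close>)
    moreover have "((Suc i, Beta (Suc i) # es), (Suc i, ins (Beta (Suc i)) es)) \<in> swaps k"
      using 2(1) ef by auto
    from swaps_Cons[OF this, of "Alpha i"]
    have "((i, Alpha i # Beta (Suc i) # es), (i, Alpha i # ins (Beta (Suc i)) es)) \<in> swaps k"
      using ef by simp
    ultimately have "((i, Beta i # Alpha (Suc i) # es), (i, Alpha i # ins (Beta (Suc i)) es)) \<in> swaps k"
      by (auto intro!: converse_rtrancl_into_rtrancl[of _ "(i, Alpha i # Beta (Suc i) # es)"])
    then show ?thesis using ef by simp
  next
    case False
    then have "ins e (f # es) = e # f # es" by (auto split: edge.splits)
    then show ?thesis by simp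
  qed
qed auto

lemma swaps_nf_word: "composable k i es \<Longrightarrow> ((i, es), (i, nf es)) \<in> swaps k"
proof (induction es arbitrary: i)
  case (Cons e es)
  then have "((i, e # es), (i, e # nf es)) \<in> swaps k"
    using swaps_Cons[of "edge_src e" es "edge_src e" "nf es" k e] by auto
  also have "((i, e # nf es), (i, ins e (nf es))) \<in> swaps k"
    using Cons.prems by (intro swaps_ins) auto
  finally show ?case by simp
qed auto

lemma sym_swaps: "sym (swaps k)"
  by (intro sym_rtrancl sym_Un_converse)

text \<open>Soundness: a swap does not change the normal form. Completeness: both words can be
  swapped into their common normal form, and swaps are reversible.\<close>

lemma word_cong_iff:
  "((i, es), (j, fs)) \<in> word_cong k \<longleftrightarrow>
     i = j \<and> composable k i es \<and> nf es = nf fs"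
proof
  assume "((i, es), (j, fs)) \<in> word_cong k"
  then show "i = j \<and> composable k i es \<and> nf es = nf fs"
    using swaps_nf[of "(i,es)" "(j,fs)"] by (auto simp: word_cong_def words_def)
next
  assume *: "i = j \<and> composable k i es \<and> nf es = nf fs"
  then have c: "composable k i fs" using composable_cong by blast
  have "((i, es), (i, nf es)) \<in> swaps k" "((i, nf es), (i, fs)) \<in> swaps k"
    using swaps_nf_word[of k i es] swaps_nf_word[OF c] * symD[OF sym_swaps, of "(i,fs)" "(i,nf fs)" k]
    by auto
  then show "((i, es), (j, fs)) \<in> word_cong k"
    using * c by (auto simp: word_cong_def words_def)
qed

section \<open>The category of paths\<close>

definition cls :: "(nat \<Rightarrow> nat) \<Rightarrow> nat \<Rightarrow> edge list \<Rightarrow> mor" where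
  "cls k i es = word_cong k `` {(i, es)}"

lemma in_cls_iff: "w \<in> cls k i es \<longleftrightarrow> fst w = i \<and> composable k i es \<and> nf es = nf (snd w)"
  unfolding cls_def by (cases w) (auto simp: word_cong_iff)

lemma cls_eq_iff:
  assumes "composable k i es" "composable k j fs"
  shows "cls k i es = cls k j fs \<longleftrightarrow> i = j \<and> nf es = nf fs"
proof
  assume eq: "cls k i es = cls k j fs"
  have "(i, es) \<in> cls k i es" using assms by (simp add: in_cls_iff)
  then show "i = j \<and> nf es = nf fs" unfolding eq by (simp add: in_cls_iff)
qed (use assms in \<open>auto simp: in_cls_iff\<close>)

lemma Lam_iff: "\<mu> \<in> Lam k \<longleftrightarrow> (\<exists>i es. composable k i es \<and> \<mu> = cls k i es)"
  unfolding Lam_def cls_def words_def quotient_def by auto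

lemma cls_Lam [simp]: "composable k i es \<Longrightarrow> cls k i es \<in> Lam k"
  unfolding Lam_iff by auto

lemma mor_rng_cls [simp]: "composable k i es \<Longrightarrow> mor_rng (cls k i es) = i"
proof -
  assume "composable k i es"
  then have "fst ` cls k i es = {i}" by (force simp: in_cls_iff image_iff)
  then show ?thesis by (simp add: mor_rng_def)
qed

lemma mor_src_cls [simp]: "composable k i es \<Longrightarrow> mor_src (cls k i es) = i + length es"
proof -
  assume c: "composable k i es"
  have "word_src w = i + length es" if "w \<in> cls k i es" for w
    using that c composable_cong[of es "snd w" k i] word_src_eq[of k i "snd w"]
    by (metis in_cls_iff length_nf prod.collapse)
  moreover have "(i, es) \<in> cls k i es" using c by (simp add: in_cls_iff)
  ultimately have "word_src ` cls k i es = {i + length es}" by force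
  then show ?thesis by (simp add: mor_src_def)
qed

text \<open>The union over all pairs of representatives collapses to one class, because replacing
  either factor by a congruent word does not change the normal form of the product.\<close>

lemma mor_comp_cls:
  assumes "composable k i es" "composable k (i + length es) fs"
  shows "mor_comp k (cls k i es) (cls k (i + length es) fs) = cls k i (es @ fs)"
proof -
  have "word_cong k `` {(fst p, snd p @ snd q)} = cls k i (es @ fs)"
    if "p \<in> cls k i es" "q \<in> cls k (i + length es) fs" for p q
  proof -
    have *: "fst p = i" "nf es = nf (snd p)" "nf fs = nf (snd q)"
      using that by (auto simp: in_cls_iff)
    then have n: "nf (snd p @ snd q) = nf (es @ fs)" by (metis nf_append_cong)
    moreover have "composable k i (es @ fs)" using assms by (simp add: composable_append)
    ultimately show ?thesis
      using cls_eq_iff composable_cong[OF n] *(1) unfolding cls_def[symmetric] by simp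
  qed
  moreover have "(i, es) \<in> cls k i es" "(i + length es, fs) \<in> cls k (i + length es) fs"
    using assms by (auto simp: in_cls_iff)
  ultimately show ?thesis unfolding mor_comp_def by blast
qed

lemma cls_cases:
  assumes "\<mu> \<in> Lam k"
  obtains es where "composable k (mor_rng \<mu>) es" "\<mu> = cls k (mor_rng \<mu>) es"
    "mor_src \<mu> = mor_rng \<mu> + length es"
  using assms unfolding Lam_iff by auto

lemma Lam_at_cls:
  assumes "\<mu> \<in> Lam k" "i = mor_rng \<mu>"
  obtains es where "composable k i es" "\<mu> = cls k i es"
  using assms cls_cases by metis

definition idm :: "(nat \<Rightarrow> nat) \<Rightarrow> nat \<Rightarrow> mor" where "idm k i = cls k i []"
definition edgem :: "(nat \<Rightarrow> nat) \<Rightarrow> edge \<Rightarrow> mor" where "edgem k e = cls k (edge_rng e) [e]"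

lemma idm_simps [simp]:
  assumes "i \<ge> 1"
  shows "idm k i \<in> Lam k" "mor_rng (idm k i) = i" "mor_src (idm k i) = i"
  using assms unfolding idm_def by simp_all

lemma edgem_simps [simp]:
  assumes "e \<in> edges k"
  shows "edgem k e \<in> Lam k" "mor_rng (edgem k e) = edge_rng e" "mor_src (edgem k e) = edge_src e"
proof -
  have "composable k (edge_rng e) [e]" using assms by (auto simp: edge_src_def)
  then show "edgem k e \<in> Lam k" "mor_rng (edgem k e) = edge_rng e" "mor_src (edgem k e) = edge_src e"
    unfolding edgem_def by (simp_all add: edge_src_def)
qed

lemma mor_rng_pos: "\<mu> \<in> Lam k \<Longrightarrow> mor_rng \<mu> \<ge> 1"
  unfolding Lam_iff using composable_pos by auto

lemma mor_rng_le_src: "\<mu> \<in> Lam k \<Longrightarrow> mor_rng \<mu> \<le> mor_src \<mu>"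
  unfolding Lam_iff by auto

lemma mor_src_pos: "\<mu> \<in> Lam k \<Longrightarrow> mor_src \<mu> \<ge> 1"
  using mor_rng_le_src mor_rng_pos le_trans by blast

lemma mor_comp_simps [simp]:
  assumes "\<mu> \<in> Lam k" "\<nu> \<in> Lam k" "mor_src \<mu> = mor_rng \<nu>"
  shows "mor_comp k \<mu> \<nu> \<in> Lam k" "mor_rng (mor_comp k \<mu> \<nu>) = mor_rng \<mu>"
    "mor_src (mor_comp k \<mu> \<nu>) = mor_src \<nu>"
proof -
  obtain i es j fs where *: "composable k i es" "\<mu> = cls k i es" "composable k j fs" "\<nu> = cls k j fs"
    using assms by (auto simp: Lam_iff)
  then have "composable k (i + length es) fs" "j = i + length es" using assms by auto
  with * show "mor_comp k \<mu> \<nu> \<in> Lam k" "mor_rng (mor_comp k \<mu> \<nu>) = mor_rng \<mu>"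
    "mor_src (mor_comp k \<mu> \<nu>) = mor_src \<nu>"
    by (auto simp: mor_comp_cls composable_append)
qed

lemma mor_comp_assoc:
  assumes "\<mu> \<in> Lam k" "\<nu> \<in> Lam k" "\<eta> \<in> Lam k" "mor_src \<mu> = mor_rng \<nu>" "mor_src \<nu> = mor_rng \<eta>"
  shows "mor_comp k (mor_comp k \<mu> \<nu>) \<eta> = mor_comp k \<mu> (mor_comp k \<nu> \<eta>)"
proof -
  obtain i es where 1: "composable k i es" "\<mu> = cls k i es"
    using assms by (auto simp: Lam_iff)
  have "i + length es = mor_rng \<nu>" using assms 1 by simp
  with assms(2) obtain fs where 2: "composable k (i + length es) fs" "\<nu> = cls k (i + length es) fs"
    by (rule Lam_at_cls)
  have "i + length es + length fs = mor_rng \<eta>" using assms 2 by simp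
  with assms(3) obtain gs where
    3: "composable k (i + length es + length fs) gs" "\<eta> = cls k (i + length es + length fs) gs"
    by (rule Lam_at_cls)
  have "mor_comp k (mor_comp k \<mu> \<nu>) \<eta> = cls k i (es @ fs @ gs)"
    using 1 2 3 mor_comp_cls[of k i "es @ fs" gs] by (simp add: mor_comp_cls composable_append add.assoc)
  also have "\<dots> = mor_comp k \<mu> (mor_comp k \<nu> \<eta>)"
    using 1 2 3 mor_comp_cls[of k "i + length es" fs gs] mor_comp_cls[of k i es "fs @ gs"]
    by (simp add: composable_append add.assoc)
  finally show ?thesis .
qed

lemma mor_comp_idm [simp]:
  assumes "\<mu> \<in> Lam k"
  shows "mor_comp k (idm k (mor_rng \<mu>)) \<mu> = \<mu>" "mor_comp k \<mu> (idm k (mor_src \<mu>)) = \<mu>"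
proof -
  obtain i es where *: "composable k i es" "\<mu> = cls k i es"
    using assms by (auto simp: Lam_iff)
  then show "mor_comp k (idm k (mor_rng \<mu>)) \<mu> = \<mu>" "mor_comp k \<mu> (idm k (mor_src \<mu>)) = \<mu>"
    using mor_comp_cls[of k i "[]" es] mor_comp_cls[of k i es "[]"] composable_append[of k i es "[]"]
      composable_pos[of k i es]
    unfolding idm_def by auto
qed

lemma mor_comp_cancel:
  assumes "\<mu> \<in> Lam k" "\<nu> \<in> Lam k" "\<eta> \<in> Lam k" "mor_src \<mu> = mor_rng \<nu>" "mor_src \<mu> = mor_rng \<eta>"
    and "mor_comp k \<mu> \<nu> = mor_comp k \<mu> \<eta>"
  shows "\<nu> = \<eta>"
proof -
  obtain i es where 1: "composable k i es" "\<mu> = cls k i es"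
    using assms by (auto simp: Lam_iff)
  have "i + length es = mor_rng \<nu>" using assms 1 by simp
  with assms(2) obtain fs where 2: "composable k (i + length es) fs" "\<nu> = cls k (i + length es) fs"
    by (rule Lam_at_cls)
  have "i + length es = mor_rng \<eta>" using assms 1 by simp
  with assms(3) obtain gs where 3: "composable k (i + length es) gs" "\<eta> = cls k (i + length es) gs"
    by (rule Lam_at_cls)
  show ?thesis using assms(6) 1 2 3
    by (auto simp: mor_comp_cls composable_append cls_eq_iff dest: nf_append_cancel)
qed

instance edge :: countable
  by countable_datatype

lemma countable_Lam: "countable (Lam k)"
proof -
  have "Lam k \<subseteq> range (\<lambda>w. cls k (fst w) (snd w))" by (force simp: Lam_iff image_iff)
  then show ?thesis by (rule countable_subset) auto
qed

section \<open>Least common multiples\<close>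

text \<open>Left divisibility up to the congruence. The cofactor \<open>vs\<close> carries no
  composability condition: if \<open>ws\<close> is composable, so is \<open>us @ vs\<close>, having
  the same normal form.\<close>

definition ldiv :: "edge list \<Rightarrow> edge list \<Rightarrow> bool" where
  "ldiv us ws \<longleftrightarrow> (\<exists>vs. nf (us @ vs) = nf ws)"

lemma extensions_cls_iff:
  assumes "composable k i us" "composable k j ws"
  shows "cls k j ws \<in> extensions k (cls k i us) \<longleftrightarrow> i = j \<and> ldiv us ws"
proof
  assume "cls k j ws \<in> extensions k (cls k i us)"
  then obtain \<eta> where \<eta>: "\<eta> \<in> Lam k" "mor_rng \<eta> = i + length us" "cls k j ws = mor_comp k (cls k i us) \<eta>"
    using assms by (auto simp: extensions_def)
  from \<eta>(1) \<eta>(2)[symmetric] obtain vs where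
    "composable k (i + length us) vs" "\<eta> = cls k (i + length us) vs"
    by (rule Lam_at_cls)
  with \<eta> assms have "cls k j ws = cls k i (us @ vs)" "composable k i (us @ vs)"
    by (auto simp: mor_comp_cls composable_append)
  with assms show "i = j \<and> ldiv us ws" unfolding ldiv_def by (metis cls_eq_iff)
next
  assume *: "i = j \<and> ldiv us ws"
  then obtain vs where "nf (us @ vs) = nf ws" by (auto simp: ldiv_def)
  moreover from this have "composable k i (us @ vs)" using * assms composable_cong by blast
  ultimately have "cls k j ws = mor_comp k (cls k i us) (cls k (i + length us) vs)"
    "composable k (i + length us) vs"
    using * assms by (auto simp: mor_comp_cls composable_append cls_eq_iff)
  then show "cls k j ws \<in> extensions k (cls k i us)"
    using assms unfolding extensions_def by force
qed

lemma ldiv_Nil [simp]: "ldiv [] ws" by (auto simp: ldiv_def)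

lemma ldiv_refl [simp]: "ldiv ws ws" unfolding ldiv_def by (metis append_Nil2)

lemma ldiv_cong: "nf us = nf us' \<Longrightarrow> nf ws = nf ws' \<Longrightarrow> ldiv us ws \<longleftrightarrow> ldiv us' ws'"
  unfolding ldiv_def by (metis nf_append_cong)

lemma ldiv_append_iff: "ldiv (us @ vs) (us @ ws) \<longleftrightarrow> ldiv vs ws"
  unfolding ldiv_def using nf_append_cancel by (metis append_assoc nf_append_cong)

lemma ldiv_Cons_iff [simp]: "ldiv (u # vs) (u # ws) \<longleftrightarrow> ldiv vs ws"
  using ldiv_append_iff[of "[u]"] by simp

lemma ldivE_append:
  assumes "ldiv us ws" obtains vs where "nf ws = nf (us @ vs)"
  using assms unfolding ldiv_def by metis

lemma ldiv_ConsE: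
  assumes "ldiv (u # us) ws" obtains vs where "nf ws = nf (u # us @ vs)"
  using ldivE_append[OF assms] by (metis append_Cons)

lemma ldiv_trans: "ldiv us vs \<Longrightarrow> ldiv vs ws \<Longrightarrow> ldiv us ws"
proof -
  assume "ldiv us vs" "ldiv vs ws"
  then obtain a b where "nf (us @ a) = nf vs" "nf (vs @ b) = nf ws" by (auto simp: ldiv_def)
  then have "nf (us @ a @ b) = nf ws" using nf_append_cong[of "us @ a" vs b b] by simp
  then show "ldiv us ws" by (auto simp: ldiv_def)
qed

lemma ldiv_appendI: "ldiv us (us @ vs)" by (auto simp: ldiv_def)

lemma ldiv_prefix: "ldiv (us @ vs) ws \<Longrightarrow> ldiv us ws"
  using ldiv_trans ldiv_appendI by blast

text \<open>Inserting \<open>e\<close> leaves \<open>e\<close> at the head unless a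
  \<open>Beta\<close> meets an \<open>Alpha\<close>, when the head becomes the \<open>Alpha\<close>
  with the index of that \<open>Beta\<close>. Distinct edges can produce the same head only in this
  way.\<close>

lemma ins_neq_heads:
  assumes "ins e es = ins f fs" "e \<noteq> f"
  shows "\<exists>i j hs. (e = Beta i \<and> f = Alpha i \<and> es = Alpha j # hs)
            \<or> (e = Alpha i \<and> f = Beta i \<and> fs = Alpha j # hs)"
  using assms by (cases e; cases f; cases es; cases fs) (auto split: edge.splits dest: ins_Beta_inject)

text \<open>By \<open>ins_neq_heads\<close> one of the edges is a \<open>Beta\<close> followed by an
  \<open>Alpha\<close> in the normalised tail; composability fixes both indices, and the relation
  rewrites this pair as the asserted divisor. All overlaps between one-edge extensions come from
  here.\<close>

lemma two_edges_ldiv: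
  assumes "composable k i ws" "ldiv [e] ws" "ldiv [f] ws" "e \<noteq> f"
  shows "{e, f} = {Alpha i, Beta i} \<and> ldiv [Alpha i, Beta (Suc i)] ws"
proof -
  have *: "{e, f} = {Alpha i, Beta i} \<and> ldiv [Alpha i, Beta (Suc i)] ws"
    if "nf ws = nf (Beta n # hs)" "nf hs = Alpha m # gs" "e = Beta n \<and> f = Alpha n \<or> e = Alpha n \<and> f = Beta n"
    for n m hs gs e f
  proof -
    have "nf ws = nf (Beta n # Alpha m # gs)"
      using that(1,2) nf_nf[of hs] by (metis ins_Alpha nf_Cons nf_nf)
    moreover from this have "n = i" "m = Suc i"
      using composable_cong[of ws "Beta n # Alpha m # gs" k i] assms(1) by auto
    moreover have "nf (Beta i # Alpha (Suc i) # gs) = nf ([Alpha i, Beta (Suc i)] @ gs)" by simp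
    ultimately have "nf ([Alpha i, Beta (Suc i)] @ gs) = nf ws" "n = i" by metis+
    then show ?thesis using that(3) unfolding ldiv_def by blast
  qed
  obtain es fs where "nf ws = nf (e # es)" "nf ws = nf (f # fs)"
    using assms by (metis ldiv_def append_Cons append_Nil)
  moreover from this ins_neq_heads[of e "nf es" f "nf fs"] assms(4) obtain n m hs where
    "(e = Beta n \<and> f = Alpha n \<and> nf es = Alpha m # hs) \<or> (e = Alpha n \<and> f = Beta n \<and> nf fs = Alpha m # hs)"
    by auto
  ultimately show ?thesis using * by blast
qed

definition is_lcm :: "(nat \<Rightarrow> nat) \<Rightarrow> nat \<Rightarrow> edge list \<Rightarrow> edge list \<Rightarrow> edge list \<Rightarrow> bool" where
  "is_lcm k i us vs ls \<longleftrightarrow> composable k i ls \<and> ldiv us ls \<and> ldiv vs ls \<and>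
     (\<forall>xs. composable k i xs \<longrightarrow> ldiv us xs \<longrightarrow> ldiv vs xs \<longrightarrow> ldiv ls xs)"

text \<open>Left cancellation turns a common multiple of \<open>e # us\<close> and
  \<open>e # vs\<close> into one of \<open>us\<close> and \<open>vs\<close>.\<close>

lemma is_lcm_Cons:
  assumes "is_lcm k (Suc i) us vs ls" "composable k i [e]"
  shows "is_lcm k i (e # us) (e # vs) (e # ls)"
  unfolding is_lcm_def
proof (intro conjI allI impI)
  fix xs assume xs: "composable k i xs" "ldiv (e # us) xs" "ldiv (e # vs) xs"
  from xs(2) obtain ys where ys: "nf xs = nf (e # us @ ys)" by (rule ldiv_ConsE)
  moreover from this have "composable k (Suc i) (us @ ys)"
    using composable_cong xs(1) assms(2) by (metis composable.simps(2) edge_src_def)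
  ultimately have "ldiv ls (us @ ys)" using xs assms(1) unfolding is_lcm_def
    by (metis ldiv_Cons_iff ldiv_cong)
  then show "ldiv (e # ls) xs" using ys by (metis ldiv_Cons_iff ldiv_cong)
qed (use assms in \<open>auto simp: is_lcm_def edge_src_def\<close>)

text \<open>
  If \<open>us\<close> and \<open>vs\<close> start with the distinct edges \<open>e\<close> and \<open>f\<close> of \<open>{\<alpha>\<^sub>i, \<beta>\<^sub>i}\<close>, then every common
  multiple is a multiple of \<open>\<alpha>\<^sub>i\<beta>\<^sub>i\<^sub>+\<^sub>1\<close>: first join \<open>us\<close> and \<open>vs\<close> separately with it, then join the two
  results.  Each step is an instance of the induction hypothesis, as it cancels an edge.
\<close>

lemma exists_lcm:
  "composable k i ws \<Longrightarrow> ldiv us ws \<Longrightarrow> ldiv vs ws \<Longrightarrow> \<exists>ls. is_lcm k i us vs ls"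
\<comment> \<open>The measure is the length of the common multiple \<open>ws\<close>, not of
  \<open>us\<close> and \<open>vs\<close>: the intermediate joins may be longer than these, but they
  still divide a tail of \<open>ws\<close>.\<close>
proof (induction "length ws" arbitrary: ws i us vs rule: less_induct)
  case less
  note compws = less.prems(1)
  consider "us = []" | "vs = []" | u us' v vs' where "us = u # us'" "vs = v # vs'"
    by (metis neq_Nil_conv)
  then show ?case
  proof cases
    case 1
    have "composable k i vs" using less.prems
      by (metis composable_append composable_cong ldivE_append)
    with 1 have "is_lcm k i us vs vs" by (auto simp: is_lcm_def)
    then show ?thesis ..
  next
    case 2
    have "composable k i us" using less.prems
      by (metis composable_append composable_cong ldivE_append)
    with 2 have "is_lcm k i us vs us" by (auto simp: is_lcm_def)
    then show ?thesis ..
  next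
    case uv: 3
    have u: "ldiv [u] ws" and v: "ldiv [v] ws" using less.prems uv ldiv_prefix[of "[u]" us' ws] 
        ldiv_prefix[of "[v]" vs' ws] by auto
    show ?thesis
    proof (cases "u = v")
      case True
      obtain ws' where ws': "nf ws = nf (u # ws')" using ldiv_ConsE[OF u] by auto
      then have c: "composable k i (u # ws')" using compws composable_cong by blast
      have "\<exists>ls. is_lcm k (Suc i) us' vs' ls"
      proof (rule less.hyps)
        show "length ws' < length ws" using arg_cong[OF ws', of length] by simp
        show "composable k (Suc i) ws'" using c by (auto simp: edge_src_def)
        show "ldiv us' ws'" "ldiv vs' ws'"
          using less.prems uv True ws' by (metis ldiv_Cons_iff ldiv_cong)+
      qed
      then show ?thesis using is_lcm_Cons[of k i us' vs' _ u] c uv True composable_pos[OF compws]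
        by (auto simp: edge_src_def)
    next
      case False
      \<comment> \<open>Here \<open>e\<close> and \<open>f\<close> are constructors rather than
        edges, so that one argument covers both orders of \<open>Alpha\<close> and
        \<open>Beta\<close>.\<close>
      obtain e f where ef: "(e, f) \<in> {(Alpha, Beta), (Beta, Alpha)}" "u = e i" "v = f i"
        and d: "ldiv [Alpha i, Beta (Suc i)] ws"
        using two_edges_ldiv[OF compws u v False] by (auto simp: doubleton_eq_iff)
      have sw: "nf (e i # f (Suc i) # xs) = nf (f i # e (Suc i) # xs)" for xs
        using ef(1) by auto
      obtain zs where zs: "nf ws = nf (e i # f (Suc i) # zs)"
      proof -
        from d obtain zs where "nf ws = nf (Alpha i # [Beta (Suc i)] @ zs)" by (rule ldiv_ConsE)
        then show ?thesis using that[of zs] ef(1) by auto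
      qed
      have zs': "nf ws = nf (f i # e (Suc i) # zs)" using zs sw by metis
      have len: "length ws = Suc (Suc (length zs))" using arg_cong[OF zs, of length] by simp
      have cz: "composable k i (e i # f (Suc i) # zs)" "composable k i (f i # e (Suc i) # zs)"
        using compws composable_cong zs zs' by blast+
      have c1: "composable k (Suc i) (f (Suc i) # zs)" "composable k (Suc i) (e (Suc i) # zs)"
        and c2: "composable k (Suc (Suc i)) zs" 
        and ce: "composable k i [e i]" "composable k i [f i]"
          "composable k (Suc i) [e (Suc i)]" "composable k (Suc i) [f (Suc i)]"
        using cz ef(1) by auto
      have "\<exists>ls. is_lcm k (Suc i) [f (Suc i)] us' ls"
        using less.prems(2) uv ef zs len c1
        by (intro less.hyps[of "f (Suc i) # zs"])
           (auto simp: ldiv_cong[OF refl zs] intro: ldiv_appendI[of "[_]", simplified])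
      then obtain ls1 where ls1: "is_lcm k (Suc i) [f (Suc i)] us' ls1" ..
      have "\<exists>ls. is_lcm k (Suc i) [e (Suc i)] vs' ls"
        using less.prems(3) uv ef zs' len c1
        by (intro less.hyps[of "e (Suc i) # zs"])
           (auto simp: ldiv_cong[OF refl zs'] intro: ldiv_appendI[of "[_]", simplified])
      then obtain ls2 where ls2: "is_lcm k (Suc i) [e (Suc i)] vs' ls2" ..
      obtain t1 where t1: "nf ls1 = nf (f (Suc i) # t1)"
        using ls1 ldiv_ConsE[of "f (Suc i)" "[]" ls1] by (auto simp: is_lcm_def)
      obtain t2 where t2: "nf ls2 = nf (e (Suc i) # t2)"
        using ls2 ldiv_ConsE[of "e (Suc i)" "[]" ls2] by (auto simp: is_lcm_def)
      \<comment> \<open>Minimality makes \<open>ls1\<close> a divisor of this tail, so its remainder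
        \<open>t1\<close> divides \<open>zs\<close>. With the same for \<open>t2\<close>, the word
        \<open>zs\<close> is the common multiple needed for the third use of the hypothesis.\<close>
      have "ldiv ls1 (f (Suc i) # zs)" using ls1 c1 less.prems(2) uv ef
        by (auto simp: is_lcm_def ldiv_cong[OF refl zs] intro: ldiv_appendI[of "[_]", simplified])
      then have d1: "ldiv t1 zs" using t1 by (metis ldiv_Cons_iff ldiv_cong)
      have "ldiv ls2 (e (Suc i) # zs)" using ls2 c1 less.prems(3) uv ef
        by (auto simp: is_lcm_def ldiv_cong[OF refl zs'] intro: ldiv_appendI[of "[_]", simplified])
      then have d2: "ldiv t2 zs" using t2 by (metis ldiv_Cons_iff ldiv_cong)
      obtain t where t: "is_lcm k (Suc (Suc i)) t1 t2 t"
        using less.hyps[of zs "Suc (Suc i)" t1 t2] len c2 d1 d2 by auto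
      have tt: "is_lcm k i (e i # f (Suc i) # t1) (e i # f (Suc i) # t2) (e i # f (Suc i) # t)"
        using is_lcm_Cons[OF is_lcm_Cons[OF t ce(4)] ce(1)] .
      have l1: "is_lcm k i [e i, f (Suc i)] us (e i # ls1)"
        using is_lcm_Cons[OF ls1 ce(1)] uv ef by simp
      have l2: "is_lcm k i [f i, e (Suc i)] vs (f i # ls2)"
        using is_lcm_Cons[OF ls2 ce(2)] uv ef by simp
      \<comment> \<open>The relation lets both joins start with the same two edges; cancelling these
        leaves the join of \<open>t1\<close> and \<open>t2\<close>.\<close>
      have n1: "nf (e i # ls1) = nf (e i # f (Suc i) # t1)" using t1 by simp
      have n2: "nf (f i # ls2) = nf (e i # f (Suc i) # t2)" using t2 sw by simp
      have "is_lcm k i us vs (e i # f (Suc i) # t)"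
        unfolding is_lcm_def
      proof (intro conjI allI impI)
        show "composable k i (e i # f (Suc i) # t)" using tt by (simp add: is_lcm_def)
        show "ldiv us (e i # f (Suc i) # t)" "ldiv vs (e i # f (Suc i) # t)"
          using l1 l2 tt n1 n2 unfolding is_lcm_def by (metis ldiv_cong ldiv_trans)+
        fix xs assume xs: "composable k i xs" "ldiv us xs" "ldiv vs xs"
        then have "ldiv [e i] xs" "ldiv [f i] xs"
          using uv ef ldiv_prefix[of "[e i]" us' xs] ldiv_prefix[of "[f i]" vs' xs] by auto
        with two_edges_ldiv[OF xs(1)] ef(1) have "ldiv [Alpha i, Beta (Suc i)] xs" by auto
        then have "ldiv [e i, f (Suc i)] xs" "ldiv [f i, e (Suc i)] xs"
          using ef(1) ldiv_cong[of "[Alpha i, Beta (Suc i)]" "[Beta i, Alpha (Suc i)]" xs xs] by auto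
        then have "ldiv (e i # ls1) xs" "ldiv (f i # ls2) xs"
          using l1 l2 xs unfolding is_lcm_def by blast+
        then have "ldiv (e i # f (Suc i) # t1) xs" "ldiv (e i # f (Suc i) # t2) xs"
          using n1 n2 by (metis ldiv_cong)+
        then show "ldiv (e i # f (Suc i) # t) xs" using tt xs unfolding is_lcm_def by blast
      qed
      then show ?thesis ..
    qed
  qed
qed

section \<open>The prefix order on morphisms\<close>

lemma Lam_at_ex:
  "\<mu> \<in> Lam k \<Longrightarrow> mor_rng \<mu> = i \<Longrightarrow> \<exists>es. composable k i es \<and> \<mu> = cls k i es"
  by (metis Lam_at_cls)

abbreviation pre :: "(nat \<Rightarrow> nat) \<Rightarrow> mor \<Rightarrow> mor \<Rightarrow> bool" where
  "pre k \<mu> \<nu> \<equiv> \<mu> \<in> prefixes_of k \<nu>"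

lemma pre_iff:
  "pre k \<mu> \<nu> \<longleftrightarrow> \<mu> \<in> Lam k \<and> (\<exists>\<eta>\<in>Lam k. mor_rng \<eta> = mor_src \<mu> \<and> \<nu> = mor_comp k \<mu> \<eta>)"
  by (auto simp: prefixes_of_def extensions_def)

lemma pre_cls_iff:
  assumes "composable k i us" "composable k j ws"
  shows "pre k (cls k i us) (cls k j ws) \<longleftrightarrow> i = j \<and> ldiv us ws"
  using assms by (simp add: prefixes_of_def extensions_cls_iff)

lemma pre_mor_comp:
  "\<mu> \<in> Lam k \<Longrightarrow> \<eta> \<in> Lam k \<Longrightarrow> mor_src \<mu> = mor_rng \<eta> \<Longrightarrow> pre k \<mu> (mor_comp k \<mu> \<eta>)"
  by (auto simp: pre_iff)

lemma pre_Lam1: "pre k \<mu> \<nu> \<Longrightarrow> \<mu> \<in> Lam k"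
  and pre_Lam2: "pre k \<mu> \<nu> \<Longrightarrow> \<nu> \<in> Lam k"
  and pre_rng: "pre k \<mu> \<nu> \<Longrightarrow> mor_rng \<mu> = mor_rng \<nu>"
  by (auto simp: pre_iff)

lemma pre_refl [simp]: "pre k \<mu> \<mu> \<longleftrightarrow> \<mu> \<in> Lam k"
  unfolding pre_iff using mor_src_pos idm_simps mor_comp_idm(2) by metis

lemma pre_trans [trans]:
  assumes "pre k \<tau> \<mu>" "pre k \<mu> \<nu>" shows "pre k \<tau> \<nu>"
proof -
  obtain \<eta> \<xi> where "\<tau> \<in> Lam k" "\<eta> \<in> Lam k" "mor_rng \<eta> = mor_src \<tau>" "\<mu> = mor_comp k \<tau> \<eta>"
    and "\<xi> \<in> Lam k" "mor_rng \<xi> = mor_src \<mu>" "\<nu> = mor_comp k \<mu> \<xi>"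
    using assms by (auto simp: pre_iff)
  then have "\<nu> = mor_comp k \<tau> (mor_comp k \<eta> \<xi>)" "mor_comp k \<eta> \<xi> \<in> Lam k"
    "mor_rng (mor_comp k \<eta> \<xi>) = mor_src \<tau>"
    by (auto simp: mor_comp_assoc)
  then show ?thesis using \<open>\<tau> \<in> Lam k\<close> unfolding pre_iff by blast
qed

lemma pre_mor_comp_iff [simp]:
  assumes "\<mu> \<in> Lam k" "\<nu> \<in> Lam k" "\<eta> \<in> Lam k" "mor_src \<mu> = mor_rng \<nu>" "mor_src \<mu> = mor_rng \<eta>"
  shows "pre k (mor_comp k \<mu> \<nu>) (mor_comp k \<mu> \<eta>) \<longleftrightarrow> pre k \<nu> \<eta>"
proof
  assume "pre k (mor_comp k \<mu> \<nu>) (mor_comp k \<mu> \<eta>)"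
  then obtain \<xi> where \<xi>: "\<xi> \<in> Lam k" "mor_rng \<xi> = mor_src \<nu>"
    "mor_comp k \<mu> \<eta> = mor_comp k (mor_comp k \<mu> \<nu>) \<xi>"
    using assms by (auto simp: pre_iff)
  then have "mor_comp k \<mu> \<eta> = mor_comp k \<mu> (mor_comp k \<nu> \<xi>)"
    using assms by (simp add: mor_comp_assoc)
  then have "\<eta> = mor_comp k \<nu> \<xi>"
    using assms \<xi> mor_comp_cancel[of \<mu> k \<eta> "mor_comp k \<nu> \<xi>"] by simp
  then show "pre k \<nu> \<eta>" using assms \<xi> by (auto simp: pre_iff)
next
  assume "pre k \<nu> \<eta>"
  then obtain \<xi> where \<xi>: "\<xi> \<in> Lam k" "mor_rng \<xi> = mor_src \<nu>" "\<eta> = mor_comp k \<nu> \<xi>"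
    using assms by (auto simp: pre_iff)
  then have "mor_comp k \<mu> \<eta> = mor_comp k (mor_comp k \<mu> \<nu>) \<xi>"
    using assms by (simp add: mor_comp_assoc)
  then show "pre k (mor_comp k \<mu> \<nu>) (mor_comp k \<mu> \<eta>)"
    using assms \<xi> by (auto simp: pre_iff)
qed

lemma pre_lcm:
  assumes "pre k \<mu> \<zeta>" "pre k \<nu> \<zeta>"
  obtains \<tau> where "pre k \<mu> \<tau>" "pre k \<nu> \<tau>" "\<And>\<xi>. pre k \<mu> \<xi> \<Longrightarrow> pre k \<nu> \<xi> \<Longrightarrow> pre k \<tau> \<xi>"
proof -
  define i where "i = mor_rng \<zeta>"
  have "i = mor_rng \<mu>" "i = mor_rng \<nu>" using assms pre_rng unfolding i_def by metis+
  then obtain us vs ws where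
    us: "composable k i us" "\<mu> = cls k i us" and vs: "composable k i vs" "\<nu> = cls k i vs"
    and ws: "composable k i ws" "\<zeta> = cls k i ws"
    using assms[THEN pre_Lam1] assms(1)[THEN pre_Lam2] Lam_at_cls i_def by metis
  then obtain ls where ls: "is_lcm k i us vs ls"
    using exists_lcm[OF ws(1), of us vs] assms by (auto simp: pre_cls_iff)
  show thesis
  proof
    show "pre k \<mu> (cls k i ls)" "pre k \<nu> (cls k i ls)"
      using ls us vs by (auto simp: is_lcm_def pre_cls_iff)
    fix \<xi> assume \<xi>: "pre k \<mu> \<xi>" "pre k \<nu> \<xi>"
    then obtain xs where "composable k i xs" "\<xi> = cls k i xs"
      using Lam_at_cls[of \<xi> k i] pre_Lam2 pre_rng \<open>i = mor_rng \<mu>\<close> by metis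
    then show "pre k (cls k i ls) \<xi>"
      using \<xi> ls us vs by (auto simp: is_lcm_def pre_cls_iff)
  qed
qed

abbreviation extend :: "(nat \<Rightarrow> nat) \<Rightarrow> mor \<Rightarrow> edge \<Rightarrow> mor" where
  "extend k \<mu> e \<equiv> mor_comp k \<mu> (edgem k e)"

lemma extend_cls:
  assumes "composable k i us" "e \<in> edges k" "edge_rng e = i + length us"
  shows "extend k (cls k i us) e = cls k i (us @ [e])" "composable k i (us @ [e])"
proof -
  have "composable k (i + length us) [e]" using assms by (auto simp: edge_src_def)
  then show "extend k (cls k i us) e = cls k i (us @ [e])" "composable k i (us @ [e])"
    using assms by (simp_all add: edgem_def mor_comp_cls composable_append)
qed

text \<open>A proper extension has a nonempty cofactor, whose first edge is the one sought. This
  reduces extensions of unknown length to single edges, the step size of the recurrence.\<close>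

lemma pre_extend:
  assumes "pre k \<mu> \<nu>" "\<mu> \<noteq> \<nu>"
  obtains e where "e \<in> edges k" "edge_rng e = mor_src \<mu>" "pre k (extend k \<mu> e) \<nu>"
proof -
  obtain i us where us: "composable k i us" "\<mu> = cls k i us"
    using pre_Lam1[OF assms(1)] by (auto simp: Lam_iff)
  have "mor_rng \<nu> = i" using pre_rng[OF assms(1)] us by simp
  then obtain ws where ws: "composable k i ws" "\<nu> = cls k i ws"
    using Lam_at_ex[OF pre_Lam2[OF assms(1)]] by blast
  obtain vs where vs: "nf ws = nf (us @ vs)"
    using assms us ws pre_cls_iff ldivE_append by metis
  then have "vs \<noteq> []" using assms us ws by (auto simp: cls_eq_iff)
  then obtain e vs' where e: "vs = e # vs'" by (cases vs) auto
  have "composable k i (us @ vs)" using ws vs composable_cong by blast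
  then have "e \<in> edges k" "edge_rng e = i + length us" using e by (auto simp: composable_append)
  moreover from this have "pre k (extend k \<mu> e) \<nu>"
    using us ws vs e ldiv_cong[OF refl vs, of "us @ [e]"] ldiv_append_iff[of us "[e]" vs]
    by (simp add: extend_cls pre_cls_iff)
  ultimately show ?thesis using that us by simp
qed

lemma extend_Alpha_Beta:
  assumes "\<mu> \<in> Lam k" "mor_src \<mu> = n"
  shows "extend k (extend k \<mu> (Alpha n)) (Beta (Suc n)) = extend k (extend k \<mu> (Beta n)) (Alpha (Suc n))"
proof -
  obtain i us where us: "composable k i us" "\<mu> = cls k i us" "n = i + length us"
    using assms by (auto simp: Lam_iff)
  have n: "n \<ge> 1" using mor_src_pos assms by blast
  have "composable k i (us @ [Alpha n] @ [Beta (Suc n)])" "composable k i (us @ [Beta n] @ [Alpha (Suc n)])"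
    using us n by (auto simp: composable_append)
  then show ?thesis using us n extend_cls[of k i us "Alpha n"]
      extend_cls[of k i us "Beta n"] extend_cls[of k i "us @ [Alpha n]" "Beta (Suc n)"]
      extend_cls[of k i "us @ [Beta n]" "Alpha (Suc n)"]
    by (auto simp: cls_eq_iff nf_append)
qed

text \<open>Cancel \<mu> and apply \<open>two_edges_ldiv\<close> to the rest. For cylinders, the
  first part gives disjointness and the second the overlap term.\<close>

lemma pre_extend_distinct:
  assumes "\<mu> \<in> Lam k" "e \<in> edges k" "edge_rng e = mor_src \<mu>" "f \<in> edges k" "edge_rng f = mor_src \<mu>"
    and "pre k (extend k \<mu> e) \<nu>" "pre k (extend k \<mu> f) \<nu>" "e \<noteq> f"
  shows "{e, f} = {Alpha (mor_src \<mu>), Beta (mor_src \<mu>)}"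
    "pre k (extend k (extend k \<mu> (Alpha (mor_src \<mu>))) (Beta (Suc (mor_src \<mu>)))) \<nu>"
proof -
  obtain i us where us: "composable k i us" "\<mu> = cls k i us"
    using assms by (auto simp: Lam_iff)
  then have src: "mor_src \<mu> = i + length us" by simp
  have e: "extend k \<mu> e = cls k i (us @ [e])" "composable k i (us @ [e])"
    and f: "extend k \<mu> f = cls k i (us @ [f])" "composable k i (us @ [f])"
    using extend_cls us assms src by auto
  have "mor_rng \<nu> = i" using pre_rng[OF assms(6)] e by simp
  then obtain ws where ws: "composable k i ws" "\<nu> = cls k i ws"
    using Lam_at_ex[OF pre_Lam2[OF assms(6)]] by blast
  have d: "ldiv (us @ [e]) ws" "ldiv (us @ [f]) ws"
    using assms e f ws by (auto simp: pre_cls_iff)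
  then obtain vs where vs: "nf ws = nf (us @ vs)" using ldiv_prefix ldivE_append by metis
  then have c: "composable k (i + length us) vs"
    using ws composable_cong composable_append by metis
  have "ldiv [e] vs" "ldiv [f] vs"
    using d ldiv_cong[OF refl vs] by (auto simp: ldiv_append_iff)
  from two_edges_ldiv[OF c this assms(8)]
  have *: "{e, f} = {Alpha (mor_src \<mu>), Beta (mor_src \<mu>)}"
    "ldiv [Alpha (mor_src \<mu>), Beta (Suc (mor_src \<mu>))] vs" using src by auto
  show "{e, f} = {Alpha (mor_src \<mu>), Beta (mor_src \<mu>)}" by fact
  have n: "mor_src \<mu> \<ge> 1" using mor_src_pos assms by blast
  have "ldiv (us @ [Alpha (mor_src \<mu>), Beta (Suc (mor_src \<mu>))]) ws"
    using * ldiv_cong[OF refl vs] by (simp add: ldiv_append_iff)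
  then show "pre k (extend k (extend k \<mu> (Alpha (mor_src \<mu>))) (Beta (Suc (mor_src \<mu>)))) \<nu>"
    using us n extend_cls[of k i us "Alpha (mor_src \<mu>)"] src ws
      extend_cls[of k i "us @ [Alpha (mor_src \<mu>)]" "Beta (Suc (mor_src \<mu>))"]
    by (simp add: pre_cls_iff)
qed

section \<open>Directed hereditary sets and the sets \<open>Z k \<mu>\<close>\<close>

lemma directed_iff:
  assumes "x \<subseteq> Lam k"
  shows "directed k x \<longleftrightarrow> (\<forall>\<mu>\<in>x. \<forall>\<nu>\<in>x. \<exists>\<zeta>\<in>x. pre k \<mu> \<zeta> \<and> pre k \<nu> \<zeta>)"
  unfolding directed_def prefixes_of_def
proof (intro ball_cong refl)
  fix \<mu> \<nu> assume "\<mu> \<in> x" "\<nu> \<in> x"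
  then show "x \<inter> extensions k \<mu> \<inter> extensions k \<nu> \<noteq> {} \<longleftrightarrow>
      (\<exists>\<zeta>\<in>x. \<mu> \<in> {\<mu> \<in> Lam k. \<zeta> \<in> extensions k \<mu>} \<and> \<nu> \<in> {\<mu> \<in> Lam k. \<zeta> \<in> extensions k \<mu>})"
    using assms by blast
qed

lemma Lam_star_iff:
  "x \<in> Lam_star k \<longleftrightarrow> x \<subseteq> Lam k \<and> x \<noteq> {} \<and>
     (\<forall>\<mu>\<in>x. \<forall>\<nu>\<in>x. \<exists>\<zeta>\<in>x. pre k \<mu> \<zeta> \<and> pre k \<nu> \<zeta>) \<and> (\<forall>\<nu>\<in>x. \<forall>\<mu>. pre k \<mu> \<nu> \<longrightarrow> \<mu> \<in> x)"
  unfolding Lam_star_def by (simp add: directed_iff hereditary_def subset_iff cong: conj_cong)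

lemma Lam_starD:
  assumes "x \<in> Lam_star k"
  shows Lam_star_sub: "\<mu> \<in> x \<Longrightarrow> \<mu> \<in> Lam k"
    and Lam_star_her: "pre k \<mu> \<nu> \<Longrightarrow> \<nu> \<in> x \<Longrightarrow> \<mu> \<in> x"
  using assms unfolding Lam_star_iff by blast+

lemma Lam_star_dir:
  assumes "x \<in> Lam_star k" "\<mu> \<in> x" "\<nu> \<in> x"
  obtains \<zeta> where "\<zeta> \<in> x" "pre k \<mu> \<zeta>" "pre k \<nu> \<zeta>"
  using assms unfolding Lam_star_iff by blast

lemma prefixes_of_Lam_star: "\<nu> \<in> Lam k \<Longrightarrow> prefixes_of k \<nu> \<in> Lam_star k"
  unfolding Lam_star_iff using pre_refl pre_trans pre_Lam1 by fast

lemma pre_idm_iff: "pre k (idm k i) \<mu> \<longleftrightarrow> \<mu> \<in> Lam k \<and> mor_rng \<mu> = i" if "i \<ge> 1"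
proof
  assume "pre k (idm k i) \<mu>"
  then show "\<mu> \<in> Lam k \<and> mor_rng \<mu> = i" using that pre_Lam2 pre_rng idm_simps by metis
next
  assume "\<mu> \<in> Lam k \<and> mor_rng \<mu> = i"
  then show "pre k (idm k i) \<mu>" using pre_mor_comp[of "idm k i" k \<mu>] that by (auto simp: mor_rng_pos)
qed

lemma Z_iff: "x \<in> Z k \<mu> \<longleftrightarrow> x \<in> Lam_star k \<and> \<mu> \<in> x"
  by (simp add: Z_def)

lemma Z_mono: "pre k \<mu> \<nu> \<Longrightarrow> Z k \<nu> \<subseteq> Z k \<mu>"
  by (auto simp: Z_iff intro: Lam_star_her)

lemma Z_idm_iff:
  assumes "x \<in> Lam_star k" "\<mu> \<in> x" "v \<ge> 1"
  shows "x \<in> Z k (idm k v) \<longleftrightarrow> mor_rng \<mu> = v"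
proof
  assume "x \<in> Z k (idm k v)"
  then obtain \<zeta> where "pre k (idm k v) \<zeta>" "pre k \<mu> \<zeta>"
    using assms by (auto simp: Z_iff elim: Lam_star_dir)
  then show "mor_rng \<mu> = v" using pre_rng assms idm_simps by metis
next
  assume "mor_rng \<mu> = v"
  then show "x \<in> Z k (idm k v)"
    using assms Lam_starD[OF assms(1)] pre_idm_iff[OF assms(3)] Z_iff by blast
qed

lemma set_rng_eq:
  assumes "x \<in> Lam_star k" "\<mu> \<in> x" shows "set_rng x = mor_rng \<mu>"
proof -
  have *: "mor_rng \<nu> = mor_rng \<mu>" if "\<nu> \<in> x" for \<nu>
    using Lam_star_dir[OF assms that] pre_rng by metis
  have "mor_rng ` x = {mor_rng \<mu>}"
    using assms(2) by (intro set_eqI) (metis * image_iff singleton_iff)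
  then show ?thesis by (simp add: set_rng_def)
qed

lemma Z_idm_eq:
  assumes "v \<ge> 1" shows "Z k (idm k v) = {x \<in> Lam_star k. set_rng x = v}"
proof -
  have "x \<in> Z k (idm k v) \<longleftrightarrow> set_rng x = v" if "x \<in> Lam_star k" for x
  proof -
    from that obtain \<mu> where "\<mu> \<in> x" unfolding Lam_star_iff by blast
    then show ?thesis using Z_idm_iff set_rng_eq that assms by metis
  qed
  then show ?thesis by (auto simp: Z_iff)
qed

text \<open>Directedness puts a common extension of \<mu> and \<nu> into any common member, so a
  least one exists, and heredity puts this least one into every common member.\<close>

lemma Z_Int_cases:
  obtains "Z k \<mu> \<inter> Z k \<nu> = {}"
  | \<tau> where "pre k \<mu> \<tau>" "pre k \<nu> \<tau>" "Z k \<mu> \<inter> Z k \<nu> = Z k \<tau>"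
proof (cases "Z k \<mu> \<inter> Z k \<nu> = {}")
  case False
  then obtain x where "x \<in> Lam_star k" "\<mu> \<in> x" "\<nu> \<in> x" by (auto simp: Z_iff)
  then obtain \<zeta> where "pre k \<mu> \<zeta>" "pre k \<nu> \<zeta>" by (auto elim: Lam_star_dir)
  then obtain \<tau> where l: "pre k \<mu> \<tau>" "pre k \<nu> \<tau>" "\<And>\<xi>. pre k \<mu> \<xi> \<Longrightarrow> pre k \<nu> \<xi> \<Longrightarrow> pre k \<tau> \<xi>"
    by (rule pre_lcm) blast
  moreover have "Z k \<mu> \<inter> Z k \<nu> = Z k \<tau>"
  proof
    show "Z k \<tau> \<subseteq> Z k \<mu> \<inter> Z k \<nu>" using l Z_mono by blast
    show "Z k \<mu> \<inter> Z k \<nu> \<subseteq> Z k \<tau>"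
      using l(3) by (auto simp: Z_iff) (metis Lam_star_dir Lam_star_her)
  qed
  ultimately show ?thesis using that by blast
qed blast

section \<open>Shifts of directed hereditary sets\<close>

text \<open>The inverse of \<open>shift k \<nu>\<close>, to be applied to members of
  \<open>Z k \<nu>\<close>.\<close>

definition unshift :: "(nat \<Rightarrow> nat) \<Rightarrow> mor \<Rightarrow> mor set \<Rightarrow> mor set" where
  "unshift k \<nu> y = {\<eta> \<in> Lam k. mor_rng \<eta> = mor_src \<nu> \<and> mor_comp k \<nu> \<eta> \<in> y}"

lemma Z_idm_rng:
  assumes "x \<in> Z k (idm k v)" "v \<ge> 1" "\<eta> \<in> x"
  shows "\<eta> \<in> Lam k" "mor_rng \<eta> = v"
  using assms Z_idm_iff Lam_star_sub by (auto simp: Z_iff)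

lemma in_shift_iff: "\<kappa> \<in> shift k \<nu> x \<longleftrightarrow> (\<exists>\<eta>\<in>x. pre k \<kappa> (mor_comp k \<nu> \<eta>))"
  by (simp add: shift_def)

lemma shift_in_Z:
  assumes "\<nu> \<in> Lam k" "x \<in> Z k (idm k (mor_src \<nu>))"
  shows "shift k \<nu> x \<in> Z k \<nu>"
proof -
  have pos: "mor_src \<nu> \<ge> 1" using assms mor_src_pos by blast
  note x = Z_idm_rng[OF assms(2) pos]
  have xs: "x \<in> Lam_star k" "idm k (mor_src \<nu>) \<in> x" using assms by (auto simp: Z_iff)
  have "pre k \<nu> (mor_comp k \<nu> (idm k (mor_src \<nu>)))"
    using assms by simp
  then have \<nu>: "\<nu> \<in> shift k \<nu> x" using xs in_shift_iff by blast
  have "shift k \<nu> x \<in> Lam_star k"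
    unfolding Lam_star_iff
  proof (intro conjI ballI allI impI)
    show "shift k \<nu> x \<noteq> {}" using \<nu> by blast
    fix \<kappa> \<kappa>' assume "\<kappa> \<in> shift k \<nu> x" "\<kappa>' \<in> shift k \<nu> x"
    then obtain \<eta> \<eta>' where \<eta>: "\<eta> \<in> x" "\<eta>' \<in> x" "pre k \<kappa> (mor_comp k \<nu> \<eta>)" "pre k \<kappa>' (mor_comp k \<nu> \<eta>')"
      by (auto simp: in_shift_iff)
    then obtain \<zeta> where \<zeta>: "\<zeta> \<in> x" "pre k \<eta> \<zeta>" "pre k \<eta>' \<zeta>" using xs(1) by (blast elim: Lam_star_dir)
    have "pre k (mor_comp k \<nu> \<eta>) (mor_comp k \<nu> \<zeta>)" "pre k (mor_comp k \<nu> \<eta>') (mor_comp k \<nu> \<zeta>)"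
      using assms(1) x \<eta> \<zeta> by auto
    moreover from this have "mor_comp k \<nu> \<zeta> \<in> shift k \<nu> x"
      using \<zeta>(1) pre_Lam2 pre_refl in_shift_iff by metis
    ultimately show "\<exists>\<zeta>\<in>shift k \<nu> x. pre k \<kappa> \<zeta> \<and> pre k \<kappa>' \<zeta>"
      using \<eta> pre_trans by blast
  qed (auto simp: in_shift_iff dest: pre_Lam1 intro: pre_trans)
  with \<nu> show ?thesis by (simp add: Z_iff)
qed

lemma unshift_shift:
  assumes "\<nu> \<in> Lam k" "x \<in> Z k (idm k (mor_src \<nu>))"
  shows "unshift k \<nu> (shift k \<nu> x) = x"
proof -
  have pos: "mor_src \<nu> \<ge> 1" using assms mor_src_pos by blast
  note x = Z_idm_rng[OF assms(2) pos]
  have "\<eta> \<in> unshift k \<nu> (shift k \<nu> x) \<longleftrightarrow> \<eta> \<in> x" for \<eta>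
  proof
    assume "\<eta> \<in> unshift k \<nu> (shift k \<nu> x)"
    then obtain \<xi> where "\<eta> \<in> Lam k" "mor_rng \<eta> = mor_src \<nu>" "\<xi> \<in> x"
      "pre k (mor_comp k \<nu> \<eta>) (mor_comp k \<nu> \<xi>)"
      by (auto simp: unshift_def in_shift_iff)
    moreover from this have "pre k \<eta> \<xi>" using assms(1) x by simp
    ultimately show "\<eta> \<in> x" using assms(2) by (auto simp: Z_iff intro: Lam_star_her)
  next
    assume "\<eta> \<in> x"
    then show "\<eta> \<in> unshift k \<nu> (shift k \<nu> x)"
      using x[of \<eta>] assms(1) unfolding unshift_def in_shift_iff by force
  qed
  then show ?thesis by blast
qed

lemma unshift_in_Z:
  assumes "y \<in> Z k \<nu>"
  shows "unshift k \<nu> y \<in> Z k (idm k (mor_src \<nu>))"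
proof -
  have y: "y \<in> Lam_star k" "\<nu> \<in> y" and \<nu>: "\<nu> \<in> Lam k" using assms by (auto simp: Z_iff Lam_star_sub)
  then have id: "idm k (mor_src \<nu>) \<in> unshift k \<nu> y"
    using mor_src_pos by (auto simp: unshift_def)
  have "unshift k \<nu> y \<in> Lam_star k"
    unfolding Lam_star_iff
  proof (intro conjI ballI allI impI)
    show "unshift k \<nu> y \<subseteq> Lam k" by (auto simp: unshift_def)
    show "unshift k \<nu> y \<noteq> {}" using id by auto
    fix \<eta> assume \<eta>: "\<eta> \<in> unshift k \<nu> y"
    then have \<eta>': "\<eta> \<in> Lam k" "mor_rng \<eta> = mor_src \<nu>" "mor_comp k \<nu> \<eta> \<in> y" by (auto simp: unshift_def)
    {
      fix \<xi> assume "\<xi> \<in> unshift k \<nu> y"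
      then have \<xi>: "\<xi> \<in> Lam k" "mor_rng \<xi> = mor_src \<nu>" "mor_comp k \<nu> \<xi> \<in> y" by (auto simp: unshift_def)
      then obtain \<zeta> where \<zeta>: "\<zeta> \<in> y" "pre k (mor_comp k \<nu> \<eta>) \<zeta>" "pre k (mor_comp k \<nu> \<xi>) \<zeta>"
        using y \<eta>' by (blast elim: Lam_star_dir)
      have "pre k \<nu> \<zeta>" using pre_trans[OF _ \<zeta>(2)] \<nu> \<eta>' by (simp add: pre_mor_comp)
      then obtain \<rho> where \<rho>: "\<rho> \<in> Lam k" "mor_rng \<rho> = mor_src \<nu>" "\<zeta> = mor_comp k \<nu> \<rho>"
        by (auto simp: pre_iff)
      then have "pre k \<eta> \<rho>" "pre k \<xi> \<rho>" "\<rho> \<in> unshift k \<nu> y"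
        using \<zeta> \<eta>' \<xi> \<nu> by (auto simp: unshift_def)
      then show "\<exists>\<rho>\<in>unshift k \<nu> y. pre k \<eta> \<rho> \<and> pre k \<xi> \<rho>" by blast
    }
    fix \<xi> assume \<xi>: "pre k \<xi> \<eta>"
    then have *: "\<xi> \<in> Lam k" "mor_rng \<xi> = mor_src \<nu>" using \<eta>' pre_Lam1 pre_rng by auto
    then have "pre k (mor_comp k \<nu> \<xi>) (mor_comp k \<nu> \<eta>)" using \<xi> \<eta>' \<nu> by simp
    then show "\<xi> \<in> unshift k \<nu> y" using * \<eta>' y by (auto simp: unshift_def intro: Lam_star_her)
  qed
  with id show ?thesis by (simp add: Z_iff)
qed

text \<open>Elements of \<open>y\<close> need not extend \<nu>. Directedness gives each of them a
  common extension with \<nu> in \<open>y\<close>, and the hereditary closure in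
  \<open>shift\<close> brings the element itself back.\<close>

lemma shift_unshift:
  assumes "y \<in> Z k \<nu>"
  shows "shift k \<nu> (unshift k \<nu> y) = y"
proof -
  have y: "y \<in> Lam_star k" "\<nu> \<in> y" and \<nu>: "\<nu> \<in> Lam k" using assms by (auto simp: Z_iff Lam_star_sub)
  have "\<kappa> \<in> shift k \<nu> (unshift k \<nu> y) \<longleftrightarrow> \<kappa> \<in> y" for \<kappa>
  proof
    assume "\<kappa> \<in> shift k \<nu> (unshift k \<nu> y)"
    then show "\<kappa> \<in> y" using y by (auto simp: in_shift_iff unshift_def intro: Lam_star_her)
  next
    assume "\<kappa> \<in> y"
    then obtain \<zeta> where \<zeta>: "\<zeta> \<in> y" "pre k \<kappa> \<zeta>" "pre k \<nu> \<zeta>" using y by (blast elim: Lam_star_dir)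
    then obtain \<rho> where "\<rho> \<in> Lam k" "mor_rng \<rho> = mor_src \<nu>" "\<zeta> = mor_comp k \<nu> \<rho>"
      by (auto simp: pre_iff)
    then show "\<kappa> \<in> shift k \<nu> (unshift k \<nu> y)" using \<zeta> by (auto simp: in_shift_iff unshift_def)
  qed
  then show ?thesis by blast
qed

lemma shift_mor_comp:
  assumes "\<nu> \<in> Lam k" "\<eta> \<in> Lam k" "mor_src \<nu> = mor_rng \<eta>" "x \<in> Z k (idm k (mor_src \<eta>))"
  shows "shift k (mor_comp k \<nu> \<eta>) x = shift k \<nu> (shift k \<eta> x)"
proof -
  have pos: "mor_src \<eta> \<ge> 1" using assms mor_src_pos by blast
  note x = Z_idm_rng[OF assms(4) pos]
  have "\<kappa> \<in> shift k (mor_comp k \<nu> \<eta>) x \<longleftrightarrow> \<kappa> \<in> shift k \<nu> (shift k \<eta> x)" for \<kappa>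
  proof
    assume "\<kappa> \<in> shift k (mor_comp k \<nu> \<eta>) x"
    then obtain \<xi> where \<xi>: "\<xi> \<in> x" "pre k \<kappa> (mor_comp k \<nu> (mor_comp k \<eta> \<xi>))"
      using assms x by (auto simp: in_shift_iff mor_comp_assoc)
    moreover have "mor_comp k \<eta> \<xi> \<in> shift k \<eta> x" 
      using \<xi> x assms unfolding in_shift_iff by force
    ultimately show "\<kappa> \<in> shift k \<nu> (shift k \<eta> x)" using in_shift_iff by metis
  next
    assume "\<kappa> \<in> shift k \<nu> (shift k \<eta> x)"
    then obtain \<xi> \<zeta> where \<xi>: "\<xi> \<in> x" "pre k \<zeta> (mor_comp k \<eta> \<xi>)" "pre k \<kappa> (mor_comp k \<nu> \<zeta>)"
      by (auto simp: in_shift_iff)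
    have "mor_comp k \<eta> \<xi> \<in> Lam k" "mor_rng (mor_comp k \<eta> \<xi>) = mor_src \<nu>"
      using \<xi>(1) x assms by auto
    moreover from this have "\<zeta> \<in> Lam k" "mor_rng \<zeta> = mor_src \<nu>"
      using pre_Lam1[OF \<xi>(2)] pre_rng[OF \<xi>(2)] by auto
    ultimately have "pre k (mor_comp k \<nu> \<zeta>) (mor_comp k \<nu> (mor_comp k \<eta> \<xi>))"
      using \<xi>(2) assms(1) by simp
    with \<xi>(3) have "pre k \<kappa> (mor_comp k \<nu> (mor_comp k \<eta> \<xi>))" by (rule pre_trans)
    then show "\<kappa> \<in> shift k (mor_comp k \<nu> \<eta>) x"
      using assms x[OF \<xi>(1)] \<xi>(1) by (auto simp: in_shift_iff mor_comp_assoc intro!: bexI[of _ \<xi>])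
  qed
  then show ?thesis by blast
qed

lemma shift_mono: "x \<subseteq> y \<Longrightarrow> shift k \<nu> x \<subseteq> shift k \<nu> y"
  by (auto simp: shift_def)

lemma unshift_mono: "x \<subseteq> y \<Longrightarrow> unshift k \<nu> x \<subseteq> unshift k \<nu> y"
  by (auto simp: unshift_def)

text \<open>A set above \<open>shift k \<nu> x\<close> contains \<nu>, so it is itself a shift by
  \<nu>; the monotone \<open>unshift\<close> places its preimage above the maximal
  \<open>x\<close>.\<close>

lemma shift_Lam_max:
  assumes "\<nu> \<in> Lam k" "x \<in> Z k (idm k (mor_src \<nu>))" "x \<in> Lam_max k"
  shows "shift k \<nu> x \<in> Lam_max k"
  unfolding Lam_max_def
proof (intro CollectI conjI ballI impI)
  show "shift k \<nu> x \<in> Lam_star k" using shift_in_Z assms by (auto simp: Z_iff)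
  fix y assume y: "y \<in> Lam_star k" "shift k \<nu> x \<subseteq> y"
  have "\<nu> \<in> y" using shift_in_Z[OF assms(1,2)] y by (auto simp: Z_iff)
  then have yZ: "y \<in> Z k \<nu>" using y by (simp add: Z_iff)
  have "x \<subseteq> unshift k \<nu> y" using unshift_mono[OF y(2), of k \<nu>] unshift_shift[OF assms(1,2)] by simp
  then have "unshift k \<nu> y = x" using assms(3) unshift_in_Z[OF yZ] by (auto simp: Lam_max_def Z_iff)
  then show "y = shift k \<nu> x" using shift_unshift[OF yZ] by simp
qed

lemma unshift_Lam_max:
  assumes "y \<in> Z k \<nu>" "y \<in> Lam_max k"
  shows "unshift k \<nu> y \<in> Lam_max k"
  unfolding Lam_max_def
proof (intro CollectI conjI ballI impI)
  have \<nu>: "\<nu> \<in> Lam k" using assms by (auto simp: Z_iff Lam_star_sub)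
  show "unshift k \<nu> y \<in> Lam_star k" using unshift_in_Z assms by (auto simp: Z_iff)
  fix z assume z: "z \<in> Lam_star k" "unshift k \<nu> y \<subseteq> z"
  then have zZ: "z \<in> Z k (idm k (mor_src \<nu>))" using unshift_in_Z[OF assms(1)] by (auto simp: Z_iff)
  have "y \<subseteq> shift k \<nu> z" using shift_mono[OF z(2), of k \<nu>] shift_unshift[OF assms(1)] by simp
  then have "shift k \<nu> z = y" using assms(2) shift_in_Z[OF \<nu> zZ] by (auto simp: Lam_max_def Z_iff)
  then show "z = unshift k \<nu> y" using unshift_shift[OF \<nu> zZ] by simp
qed

section \<open>Topology of the boundary\<close>

lemma openin_base:
  assumes "\<kappa> \<in> Lam k" "finite F" "F \<subseteq> Lam k"
  shows "openin (Lam_star_top k) (Z k \<kappa> - (\<Union>\<mu>\<in>F. Z k \<mu>))"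
  unfolding Lam_star_top_def using assms by (intro topology_generated_by_Basis) blast

lemma Z_empty: "\<kappa> \<notin> Lam k \<Longrightarrow> Z k \<kappa> = {}"
  using Lam_star_sub by (auto simp: Z_iff)

lemma Z_sub: "Z k \<kappa> \<subseteq> Lam_star k"
  by (auto simp: Z_iff)

lemma Lam_star_obtain:
  assumes "x \<in> Lam_star k" obtains \<kappa> where "\<kappa> \<in> Lam k" "x \<in> Z k \<kappa>"
  using assms unfolding Z_iff Lam_star_iff by blast

lemma topspace_Lam_star_top [simp]: "topspace (Lam_star_top k) = Lam_star k"
proof
  show "topspace (Lam_star_top k) \<subseteq> Lam_star k"
    unfolding Lam_star_top_def topology_generated_by_topspace using Z_sub by blast
  show "Lam_star k \<subseteq> topspace (Lam_star_top k)"
  proof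
    fix x assume "x \<in> Lam_star k"
    then obtain \<kappa> where "\<kappa> \<in> Lam k" "x \<in> Z k \<kappa>" by (rule Lam_star_obtain)
    then show "x \<in> topspace (Lam_star_top k)"
      using openin_subset[OF openin_base[of \<kappa> k "{}"]] by auto
  qed
qed

lemma openin_Z [simp]: "openin (Lam_star_top k) (Z k \<kappa>)"
  using openin_base[of \<kappa> k "{}"] Z_empty by (cases "\<kappa> \<in> Lam k") auto

text \<open>The complement is the union of the basic sets \<open>Z k \<kappa> - Z k \<mu>\<close>
  over all \<kappa>.\<close>

lemma closedin_Z [simp]: "closedin (Lam_star_top k) (Z k \<mu>)"
proof -
  have "openin (Lam_star_top k) (Lam_star k - Z k \<mu>)"
  proof (cases "\<mu> \<in> Lam k")
    case True
    then have "openin (Lam_star_top k) (\<Union>\<kappa>\<in>Lam k. Z k \<kappa> - (\<Union>\<mu>\<in>{\<mu>}. Z k \<mu>))"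
      by (intro openin_Union) (use openin_base in blast)
    moreover have "(\<Union>\<kappa>\<in>Lam k. Z k \<kappa> - (\<Union>\<mu>\<in>{\<mu>}. Z k \<mu>)) = Lam_star k - Z k \<mu>"
      by (auto simp: Z_sub[THEN subsetD] elim: Lam_star_obtain)
    ultimately show ?thesis by simp
  next
    case False
    then show ?thesis using openin_topspace[of "Lam_star_top k"] by (simp add: Z_empty)
  qed
  then show ?thesis by (simp add: closedin_def Z_sub)
qed

lemma Lam_star_top_base:
  assumes "openin (Lam_star_top k) U" "x \<in> U"
  shows "\<exists>\<kappa> F. \<kappa> \<in> Lam k \<and> finite F \<and> F \<subseteq> Lam k \<and>
           x \<in> Z k \<kappa> - (\<Union>\<mu>\<in>F. Z k \<mu>) \<and> Z k \<kappa> - (\<Union>\<mu>\<in>F. Z k \<mu>) \<subseteq> U"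
  using assms(1)[unfolded Lam_star_top_def openin_topology_generated_by_iff] assms(2)
proof (induction rule: generate_topology_on.induct)
  case (Int U V)
  then have "x \<in> U" "x \<in> V" by auto
  from Int.IH(1)[OF this(1)] obtain \<kappa> F where
    1: "\<kappa> \<in> Lam k" "finite F" "F \<subseteq> Lam k" "x \<in> Z k \<kappa> - (\<Union>\<mu>\<in>F. Z k \<mu>)"
      "Z k \<kappa> - (\<Union>\<mu>\<in>F. Z k \<mu>) \<subseteq> U"
    by (elim exE conjE)
  from Int.IH(2)[OF \<open>x \<in> V\<close>] obtain \<kappa>' F' where
    2: "\<kappa>' \<in> Lam k" "finite F'" "F' \<subseteq> Lam k" "x \<in> Z k \<kappa>' - (\<Union>\<mu>\<in>F'. Z k \<mu>)"
      "Z k \<kappa>' - (\<Union>\<mu>\<in>F'. Z k \<mu>) \<subseteq> V"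
    by (elim exE conjE)
  from 1(4) 2(4) have x: "x \<in> Lam_star k" "\<kappa> \<in> x" "\<kappa>' \<in> x" by (auto simp: Z_iff)
  then obtain \<zeta> where \<zeta>: "\<zeta> \<in> x" "pre k \<kappa> \<zeta>" "pre k \<kappa>' \<zeta>" by (rule Lam_star_dir)
  have "Z k \<zeta> \<subseteq> Z k \<kappa> \<inter> Z k \<kappa>'" using Z_mono \<zeta> by blast
  moreover have "\<zeta> \<in> Lam k" "x \<in> Z k \<zeta>" using \<zeta> pre_Lam2 x Z_iff by blast+
  ultimately show ?case using 1 2
    by (intro exI[of _ \<zeta>] exI[of _ "F \<union> F'"]) (auto dest: subsetD)
next
  case (UN \<U>)
  then obtain V where V: "V \<in> \<U>" "x \<in> V" by blast
  from UN.IH[OF this] show ?case using V by (meson Sup_upper order_trans)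
next
  case (Basis s)
  then show ?case by blast
qed simp

lemma continuous_map_Lam_star_top:
  assumes "\<And>x. x \<in> topspace X \<Longrightarrow> f x \<in> Lam_star k"
    and "\<And>\<kappa>. \<kappa> \<in> Lam k \<Longrightarrow> openin X {x \<in> topspace X. f x \<in> Z k \<kappa>}"
    and "\<And>\<kappa>. \<kappa> \<in> Lam k \<Longrightarrow> openin X {x \<in> topspace X. f x \<notin> Z k \<kappa>}"
  shows "continuous_map X (Lam_star_top k) f"
  unfolding Lam_star_top_def
proof (rule continuous_on_generated_topo)
  fix U assume "U \<in> {Z k \<kappa> - (\<Union>\<mu>\<in>F. Z k \<mu>) |\<kappa> F. \<kappa> \<in> Lam k \<and> finite F \<and> F \<subseteq> Lam k}"
  then obtain \<kappa> F where U: "U = Z k \<kappa> - (\<Union>\<mu>\<in>F. Z k \<mu>)" "\<kappa> \<in> Lam k" "finite F" "F \<subseteq> Lam k" by blast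
  have "openin X (\<Inter>\<mu>\<in>F. {x \<in> topspace X. f x \<notin> Z k \<mu>})" if "F \<noteq> {}"
    using U that assms(3) by (intro openin_Inter) auto
  then have "openin X ({x \<in> topspace X. f x \<in> Z k \<kappa>} \<inter> (\<Inter>\<mu>\<in>F. {x \<in> topspace X. f x \<notin> Z k \<mu>}))"
    using assms(2)[OF U(2)] by (cases "F = {}") (auto intro: openin_Int)
  moreover have "{x \<in> topspace X. f x \<in> Z k \<kappa>} \<inter> (\<Inter>\<mu>\<in>F. {x \<in> topspace X. f x \<notin> Z k \<mu>})
      = f -` U \<inter> topspace X"
    unfolding U(1) by auto
  ultimately show "openin X (f -` U \<inter> topspace X)" by simp
next
  have "f ` topspace X \<subseteq> topspace (Lam_star_top k)" using assms(1) by auto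
  then show "f ` topspace X \<subseteq> \<Union>{Z k \<kappa> - (\<Union>\<mu>\<in>F. Z k \<mu>) |\<kappa> F. \<kappa> \<in> Lam k \<and> finite F \<and> F \<subseteq> Lam k}"
    unfolding Lam_star_top_def topology_generated_by_topspace .
qed

lemma openin_Diff_Z: "openin (Lam_star_top k) U \<Longrightarrow> openin (Lam_star_top k) (U - Z k \<kappa>)"
  by (simp add: openin_diff)

lemma openin_Z_subtopology:
  assumes "openin (Lam_star_top k) U"
  shows "openin (subtopology (Lam_star_top k) U) (U \<inter> Z k \<kappa>)"
    "openin (subtopology (Lam_star_top k) U) (U - Z k \<kappa>)"
  using assms openin_Diff_Z by (auto simp: openin_open_subtopology)

lemma unshift_in_Z_iff:
  assumes "y \<in> Z k \<nu>" "\<kappa> \<in> Lam k"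
  shows "unshift k \<nu> y \<in> Z k \<kappa> \<longleftrightarrow> mor_rng \<kappa> = mor_src \<nu> \<and> y \<in> Z k (mor_comp k \<nu> \<kappa>)"
  using unshift_in_Z[OF assms(1)] assms unfolding Z_iff unshift_def by auto

lemma shift_in_Z_iff:
  assumes "\<nu> \<in> Lam k" "x \<in> Z k (idm k (mor_src \<nu>))" "\<eta> \<in> Lam k" "mor_rng \<eta> = mor_src \<nu>"
  shows "shift k \<nu> x \<in> Z k (mor_comp k \<nu> \<eta>) \<longleftrightarrow> x \<in> Z k \<eta>"
  using unshift_in_Z_iff[OF shift_in_Z[OF assms(1,2)] assms(3)] unshift_shift[OF assms(1,2)] assms(4)
  by simp

lemma continuous_unshift:
  "continuous_map (subtopology (Lam_star_top k) (Z k \<nu>)) (Lam_star_top k) (unshift k \<nu>)"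
proof (rule continuous_map_Lam_star_top)
  have ts: "topspace (subtopology (Lam_star_top k) (Z k \<nu>)) = Z k \<nu>"
    using Z_sub by auto
  show "unshift k \<nu> y \<in> Lam_star k" if "y \<in> topspace (subtopology (Lam_star_top k) (Z k \<nu>))" for y
    using that unshift_in_Z Z_sub unfolding ts by blast
  fix \<kappa> assume \<kappa>: "\<kappa> \<in> Lam k"
  show "openin (subtopology (Lam_star_top k) (Z k \<nu>))
          {y \<in> topspace (subtopology (Lam_star_top k) (Z k \<nu>)). unshift k \<nu> y \<in> Z k \<kappa>}"
  proof (cases "mor_rng \<kappa> = mor_src \<nu>")
    case True
    then have "{y \<in> Z k \<nu>. unshift k \<nu> y \<in> Z k \<kappa>} = Z k \<nu> \<inter> Z k (mor_comp k \<nu> \<kappa>)"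
      using unshift_in_Z_iff \<kappa> by auto
    then show ?thesis unfolding ts by (simp add: openin_Z_subtopology)
  next
    case False
    then have "{y \<in> Z k \<nu>. unshift k \<nu> y \<in> Z k \<kappa>} = {}"
      using unshift_in_Z_iff \<kappa> by auto
    then show ?thesis unfolding ts by (metis openin_empty)
  qed
  show "openin (subtopology (Lam_star_top k) (Z k \<nu>))
          {y \<in> topspace (subtopology (Lam_star_top k) (Z k \<nu>)). unshift k \<nu> y \<notin> Z k \<kappa>}"
  proof (cases "mor_rng \<kappa> = mor_src \<nu>")
    case True
    then have "{y \<in> Z k \<nu>. unshift k \<nu> y \<notin> Z k \<kappa>} = Z k \<nu> - Z k (mor_comp k \<nu> \<kappa>)"
      using unshift_in_Z_iff \<kappa> by auto
    then show ?thesis unfolding ts by (simp add: openin_Z_subtopology)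
  next
    case False
    then have "{y \<in> Z k \<nu>. unshift k \<nu> y \<notin> Z k \<kappa>} = Z k \<nu>"
      using unshift_in_Z_iff \<kappa> by auto
    then show ?thesis unfolding ts by (metis openin_topspace ts)
  qed
qed

text \<open>All images lie in \<open>Z k \<nu>\<close>. If this set meets
  \<open>Z k \<kappa>\<close>, the intersection is the \<open>Z\<close> of a least common multiple
  \<open>mor_comp k \<nu> \<eta>\<close>, and the preimage of \<open>Z k \<kappa>\<close> is the
  part of \<open>Z k \<eta>\<close> in the domain; otherwise it is empty.\<close>

lemma continuous_shift:
  assumes \<nu>: "\<nu> \<in> Lam k"
  shows "continuous_map (subtopology (Lam_star_top k) (Z k (idm k (mor_src \<nu>)))) (Lam_star_top k) (shift k \<nu>)"
    (is "continuous_map ?X _ _")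
proof (rule continuous_map_Lam_star_top)
  let ?U = "Z k (idm k (mor_src \<nu>))"
  have ts: "topspace ?X = ?U" using Z_sub by auto
  show "shift k \<nu> x \<in> Lam_star k" if "x \<in> topspace ?X" for x
    using that shift_in_Z[OF \<nu>] Z_sub unfolding ts by blast
  fix \<kappa>
  have "openin ?X {x \<in> topspace ?X. shift k \<nu> x \<in> Z k \<kappa>} \<and> openin ?X {x \<in> topspace ?X. shift k \<nu> x \<notin> Z k \<kappa>}"
  proof (cases rule: Z_Int_cases[of k \<nu> \<kappa>])
    case 1
    then have "{x \<in> ?U. shift k \<nu> x \<in> Z k \<kappa>} = {}" "{x \<in> ?U. shift k \<nu> x \<notin> Z k \<kappa>} = ?U"
      using shift_in_Z[OF \<nu>] by blast+
    then show ?thesis unfolding ts by (metis openin_empty openin_topspace ts)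
  next
    case (2 \<tau>)
    then obtain \<eta> where \<eta>: "\<eta> \<in> Lam k" "mor_rng \<eta> = mor_src \<nu>" "\<tau> = mor_comp k \<nu> \<eta>"
      by (auto simp: pre_iff)
    have *: "shift k \<nu> x \<in> Z k \<kappa> \<longleftrightarrow> x \<in> Z k \<eta>" if "x \<in> ?U" for x
    proof -
      have "shift k \<nu> x \<in> Z k \<kappa> \<longleftrightarrow> shift k \<nu> x \<in> Z k \<nu> \<inter> Z k \<kappa>"
        using shift_in_Z[OF \<nu> that] by blast
      also have "\<dots> \<longleftrightarrow> x \<in> Z k \<eta>"
        unfolding 2(3) \<eta>(3) by (rule shift_in_Z_iff[OF \<nu> that \<eta>(1,2)])
      finally show ?thesis .
    qed
    have "{x \<in> ?U. shift k \<nu> x \<in> Z k \<kappa>} = ?U \<inter> Z k \<eta>" "{x \<in> ?U. shift k \<nu> x \<notin> Z k \<kappa>} = ?U - Z k \<eta>"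
      using * by blast+
    then show ?thesis unfolding ts by (simp add: openin_Z_subtopology)
  qed
  then show "openin ?X {x \<in> topspace ?X. shift k \<nu> x \<in> Z k \<kappa>}"
    "openin ?X {x \<in> topspace ?X. shift k \<nu> x \<notin> Z k \<kappa>}" by auto
qed

section \<open>The boundary: shifts, compactness, one-edge extensions\<close>

lemma bdry_sub: "bdry k \<subseteq> Lam_star k"
  unfolding bdry_def using closure_of_subset_topspace[of "Lam_star_top k"] by simp

lemma bdry_at_eq: "v \<ge> 1 \<Longrightarrow> bdry_at k v = bdry k \<inter> Z k (idm k v)"
  unfolding bdry_at_def Z_idm_eq using bdry_sub by blast

text \<open>Since \<open>Z k \<mu>\<close> is open, boundary points in it are limits of maximal
  points in it, and continuity carries such limits to limits of maximal points.\<close>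

lemma bdry_Int_Z_image:
  assumes cont: "continuous_map (subtopology (Lam_star_top k) (Z k \<mu>)) (Lam_star_top k) f"
    and max: "\<And>x. x \<in> Z k \<mu> \<Longrightarrow> x \<in> Lam_max k \<Longrightarrow> f x \<in> Lam_max k"
  shows "f ` (bdry k \<inter> Z k \<mu>) \<subseteq> bdry k"
proof -
  let ?X = "subtopology (Lam_star_top k) (Z k \<mu>)"
  have "bdry k \<inter> Z k \<mu> = ?X closure_of Lam_max k"
    unfolding bdry_def by (simp add: closure_of_subtopology_open Int_commute)
  also have "\<dots> = ?X closure_of (topspace ?X \<inter> Lam_max k)"
    by (rule closure_of_restrict)
  finally have "f ` (bdry k \<inter> Z k \<mu>) \<subseteq> Lam_star_top k closure_of f ` (topspace ?X \<inter> Lam_max k)"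
    using continuous_map_image_closure_subset[OF cont] by metis
  also have "\<dots> \<subseteq> bdry k"
    unfolding bdry_def using max by (intro closure_of_mono) auto
  finally show ?thesis .
qed

lemma shift_image_bdry:
  assumes "\<nu> \<in> Lam k"
  shows "shift k \<nu> ` bdry_at k (mor_src \<nu>) = bdry k \<inter> Z k \<nu>"
proof -
  note eq = bdry_at_eq[OF mor_src_pos[OF assms]]
  have "shift k \<nu> ` bdry_at k (mor_src \<nu>) \<subseteq> bdry k \<inter> Z k \<nu>"
    unfolding eq using bdry_Int_Z_image[OF continuous_shift[OF assms] shift_Lam_max[OF assms]]
      shift_in_Z[OF assms] by blast
  moreover have "unshift k \<nu> ` (bdry k \<inter> Z k \<nu>) \<subseteq> bdry_at k (mor_src \<nu>)"
    unfolding eq using bdry_Int_Z_image[OF continuous_unshift unshift_Lam_max] unshift_in_Z by blast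
  then have "y \<in> shift k \<nu> ` bdry_at k (mor_src \<nu>)" if "y \<in> bdry k \<inter> Z k \<nu>" for y
    using that shift_unshift[of y k \<nu>] by (intro image_eqI[of y _ "unshift k \<nu> y"]) auto
  ultimately show ?thesis by blast
qed

text \<open>
  Given a subbasic cover without finite subcover, let \<open>P\<close> collect the \<open>\<mu>\<close> whose complements
  \<open>\<Lambda>\<^sup>* - Z(\<mu>)\<close> occur in it.  The set \<open>x\<close> of all morphisms forced by finitely many members of \<open>P\<close> is
  directed because of the least common multiples, and it lies in no member of the cover.
\<close>

lemma compactin_Z_idm:
  assumes v: "v \<ge> 1"
  shows "compactin (Lam_star_top k) (Z k (idm k v))"
proof -
  define U where "U = Z k (idm k v)"
  define B where "B = range (Z k) \<union> range (\<lambda>\<mu>. Lam_star k - Z k \<mu>)"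
  \<comment> \<open>The space \<open>U\<close> with the sets \<open>Z k \<kappa>\<close> and their
    complements as subbase, the form required by Alexander's theorem. Continuity of the inclusion
    into \<open>Lam_star_top k\<close> then transfers compactness.\<close>
  define X where "X = topology (arbitrary union_of (finite intersection_of (\<lambda>b. b \<in> B) relative_to U))"
  have ts: "topspace X = U" unfolding X_def by simp
  have "compact_space X"
  proof (rule Alexander_subbase_alt)
    show "U \<subseteq> \<Union>B" unfolding U_def B_def by blast
    show "topology (arbitrary union_of (finite intersection_of (\<lambda>b. b \<in> B) relative_to U)) = X"
      by (simp add: X_def)
    fix C assume C: "C \<subseteq> B" "U \<subseteq> \<Union>C"
    show "\<exists>C'. finite C' \<and> C' \<subseteq> C \<and> U \<subseteq> \<Union>C'"
    proof (rule ccontr)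
      assume neg: "\<nexists>C'. finite C' \<and> C' \<subseteq> C \<and> U \<subseteq> \<Union>C'"
      define P where "P = {\<mu>. Lam_star k - Z k \<mu> \<in> C}"
      define x where "x = {\<kappa>. \<exists>Q. finite Q \<and> Q \<subseteq> P \<and> (\<forall>y\<in>U. Q \<subseteq> y \<longrightarrow> \<kappa> \<in> y)}"
      have U_star: "U \<subseteq> Lam_star k" unfolding U_def by (rule Z_sub)
      \<comment> \<open>The absence of a finite subcover is applied to \<open>C'\<close> together
        with the complements belonging to \<open>Q\<close>: a point outside such a complement
        contains the corresponding \<mu>.\<close>
      have avoid: "\<exists>y\<in>U. Q \<subseteq> y \<and> (\<forall>c\<in>C'. y \<notin> c)"
        if Q: "finite Q" "Q \<subseteq> P" and C': "finite C'" "C' \<subseteq> C" for Q C'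
      proof -
        have "finite (C' \<union> (\<lambda>\<mu>. Lam_star k - Z k \<mu>) ` Q)" "C' \<union> (\<lambda>\<mu>. Lam_star k - Z k \<mu>) ` Q \<subseteq> C"
          using Q C' by (auto simp: P_def)
        with neg have "\<not> U \<subseteq> \<Union>(C' \<union> (\<lambda>\<mu>. Lam_star k - Z k \<mu>) ` Q)" by blast
        then obtain y where "y \<in> U" "\<forall>c\<in>C'. y \<notin> c" "\<forall>\<mu>\<in>Q. y \<notin> Lam_star k - Z k \<mu>" by blast
        moreover from this have "Q \<subseteq> y" using U_star Z_iff by blast
        ultimately show ?thesis by blast
      qed
      have x_star: "x \<in> Lam_star k"
        unfolding Lam_star_iff
      proof (intro conjI ballI allI impI)
        show "x \<subseteq> Lam k"
        proof
          fix \<kappa> assume "\<kappa> \<in> x"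
          then obtain Q where Q: "finite Q" "Q \<subseteq> P" "\<forall>y\<in>U. Q \<subseteq> y \<longrightarrow> \<kappa> \<in> y" by (auto simp: x_def)
          from avoid[OF Q(1,2), of "{}"] obtain y where "y \<in> U" "Q \<subseteq> y" by auto
          with Q U_star show "\<kappa> \<in> Lam k" using Lam_star_sub by blast
        qed
        have "idm k v \<in> x" unfolding x_def U_def by (auto simp: Z_iff)
        then show "x \<noteq> {}" by blast
        fix \<mu> assume "\<mu> \<in> x"
        then obtain Q where Q: "finite Q" "Q \<subseteq> P" "\<forall>y\<in>U. Q \<subseteq> y \<longrightarrow> \<mu> \<in> y" by (auto simp: x_def)
        {
          fix \<nu> assume "\<nu> \<in> x"
          then obtain R where R: "finite R" "R \<subseteq> P" "\<forall>y\<in>U. R \<subseteq> y \<longrightarrow> \<nu> \<in> y" by (auto simp: x_def)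
          have QR: "finite (Q \<union> R)" "Q \<union> R \<subseteq> P" using Q R by auto
          have join: "\<exists>\<zeta>\<in>y. pre k \<mu> \<zeta> \<and> pre k \<nu> \<zeta>" if "y \<in> U" "Q \<union> R \<subseteq> y" for y
          proof -
            have "\<mu> \<in> y" using that Q(3) by simp
            moreover have "\<nu> \<in> y" using that R(3) by simp
            ultimately show ?thesis using that(1) U_star Lam_star_iff by blast
          qed
          from avoid[OF QR, of "{}"] obtain y where "y \<in> U" "Q \<union> R \<subseteq> y" by auto
          with join obtain \<zeta> where "pre k \<mu> \<zeta>" "pre k \<nu> \<zeta>" by blast
          \<comment> \<open>A common extension picked inside each \<open>y\<close> would vary with
            \<open>y\<close>; the least one lies in all of them and is therefore forced.\<close>
          then obtain \<tau> where \<tau>: "pre k \<mu> \<tau>" "pre k \<nu> \<tau>"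
            "\<And>\<xi>. pre k \<mu> \<xi> \<Longrightarrow> pre k \<nu> \<xi> \<Longrightarrow> pre k \<tau> \<xi>" by (rule pre_lcm) blast
          have "\<tau> \<in> y" if "y \<in> U" "Q \<union> R \<subseteq> y" for y
            using join[OF that] \<tau>(3) Lam_star_her[of y k] subsetD[OF U_star that(1)] by metis
          then have "\<tau> \<in> x" unfolding x_def using QR by blast
          then show "\<exists>\<zeta>\<in>x. pre k \<mu> \<zeta> \<and> pre k \<nu> \<zeta>" using \<tau> by blast
        }
        fix \<kappa> assume "pre k \<kappa> \<mu>"
        then have "\<forall>y\<in>U. Q \<subseteq> y \<longrightarrow> \<kappa> \<in> y"
          using Q(3) Lam_star_her[of _ k \<kappa> \<mu>] subsetD[OF U_star] by metis
        then show "\<kappa> \<in> x" unfolding x_def using Q by blast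
      qed
      have "idm k v \<in> x" unfolding x_def U_def by (auto simp: Z_iff)
      then have "x \<in> U" using x_star by (simp add: U_def Z_iff)
      then obtain c where c: "c \<in> C" "x \<in> c" using C by blast
      then consider \<kappa> where "c = Z k \<kappa>" | \<mu> where "c = Lam_star k - Z k \<mu>" using C by (auto simp: B_def)
      then show False
      proof cases
        \<comment> \<open>Here \<kappa> is forced by a finite \<open>Q\<close>, so
          \<open>Z k \<kappa>\<close> and the complements belonging to \<open>Q\<close> would
          already cover \<open>U\<close>.\<close>
        case 1
        with c obtain Q where Q: "finite Q" "Q \<subseteq> P" "\<forall>y\<in>U. Q \<subseteq> y \<longrightarrow> \<kappa> \<in> y"
          by (auto simp: x_def Z_iff)
        from avoid[OF Q(1,2), of "{c}"] c obtain y where "y \<in> U" "Q \<subseteq> y" "y \<notin> c" by auto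
        then show False using Q 1 U_star by (auto simp: Z_iff)
      next
        case 2
        then have "\<mu> \<in> P" using c by (simp add: P_def)
        then have "\<mu> \<in> x" unfolding x_def by (auto intro!: exI[of _ "{\<mu>}"])
        then show False using c 2 x_star by (simp add: Z_iff)
      qed
    qed
  qed
  moreover have "continuous_map X (Lam_star_top k) (\<lambda>x. x)"
  proof (rule continuous_map_Lam_star_top)
    have sub: "openin X (U \<inter> b)" if "b \<in> B" for b
      unfolding X_def openin_subbase
      using that by (intro arbitrary_union_of_inc relative_to_inc finite_intersection_of_inc)
    fix \<kappa>
    have "{x \<in> topspace X. x \<in> Z k \<kappa>} = U \<inter> Z k \<kappa>"
      "{x \<in> topspace X. x \<notin> Z k \<kappa>} = U \<inter> (Lam_star k - Z k \<kappa>)"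
      unfolding ts U_def using Z_sub by blast+
    then show "openin X {x \<in> topspace X. x \<in> Z k \<kappa>}" "openin X {x \<in> topspace X. x \<notin> Z k \<kappa>}"
      using sub[of "Z k \<kappa>"] sub[of "Lam_star k - Z k \<kappa>"] by (auto simp: B_def)
  qed (use Z_sub ts U_def in blast)
  ultimately have "compactin (Lam_star_top k) ((\<lambda>x. x) ` topspace X)"
    by (intro image_compactin) (auto simp: compact_space_def)
  then show ?thesis by (simp add: ts U_def)
qed

lemma compactin_bdry_at: "v \<ge> 1 \<Longrightarrow> compactin (Lam_star_top k) (bdry_at k v)"
  unfolding bdry_at_eq
  using compact_Int_closedin[OF compactin_Z_idm, where T = "bdry k"]
  by (simp add: bdry_def Int_commute)

text \<open>
  Since only finitely many edges have range \<open>s(\<mu>)\<close>, a boundary point violating this would have a maximal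
  point \<open>y\<close> violating it nearby; but then \<open>y \<subseteq> [\<mu>]\<close>, which is properly contained in \<open>[\<mu>\<alpha>]\<close>.
\<close>

lemma bdry_extend:
  assumes "x \<in> bdry k" "\<mu> \<in> x"
  shows "\<exists>e\<in>edges k. edge_rng e = mor_src \<mu> \<and> extend k \<mu> e \<in> x"
proof (rule ccontr)
  assume neg: "\<not> ?thesis"
  define n where "n = mor_src \<mu>"
  define Ed where "Ed = {e \<in> edges k. edge_rng e = n}"
  define W where "W = Z k \<mu> - (\<Union>\<nu>\<in>extend k \<mu> ` Ed. Z k \<nu>)"
  have x: "x \<in> Lam_star k" using assms bdry_sub by blast
  then have \<mu>: "\<mu> \<in> Lam k" using assms Lam_star_sub by blast
  have "Ed \<subseteq> {Alpha n, Beta n} \<union> Gamma n ` {1..k n}" unfolding Ed_def edges_def by auto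
  then have "finite Ed" by (rule finite_subset) auto
  then have "openin (Lam_star_top k) W"
    unfolding W_def using \<mu> by (intro openin_base) (auto simp: Ed_def n_def)
  moreover have "x \<in> W" using neg x assms by (auto simp: W_def Ed_def n_def Z_iff)
  ultimately obtain y where y: "y \<in> Lam_max k" "y \<in> W"
    using assms(1) unfolding bdry_def in_closure_of by blast
  then have ys: "y \<in> Lam_star k" "\<mu> \<in> y" "\<And>e. e \<in> Ed \<Longrightarrow> extend k \<mu> e \<notin> y"
    by (auto simp: W_def Z_iff)
  have "n \<ge> 1" using mor_src_pos[OF \<mu>] by (simp add: n_def)
  then have \<alpha>: "Alpha n \<in> Ed" by (simp add: Ed_def)
  have ext: "extend k \<mu> (Alpha n) \<in> Lam k" "pre k \<mu> (extend k \<mu> (Alpha n))"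
    using \<mu> \<open>n \<ge> 1\<close> by (auto simp: n_def intro!: pre_mor_comp)
  have "y \<subseteq> prefixes_of k (extend k \<mu> (Alpha n))"
  proof
    fix \<nu> assume "\<nu> \<in> y"
    then obtain \<zeta> where \<zeta>: "\<zeta> \<in> y" "pre k \<mu> \<zeta>" "pre k \<nu> \<zeta>" using ys by (blast elim: Lam_star_dir)
    \<comment> \<open>A proper extension \<zeta> of \<mu> would bring a one-edge extension of \<mu>
      into \<open>y\<close>.\<close>
    have "\<mu> = \<zeta>"
    proof (rule ccontr)
      assume "\<mu> \<noteq> \<zeta>"
      from pre_extend[OF \<zeta>(2) this] obtain e where "e \<in> Ed" "pre k (extend k \<mu> e) \<zeta>"
        by (auto simp: Ed_def n_def)
      then show False using ys \<zeta>(1) Lam_star_her by blast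
    qed
    then show "pre k \<nu> (extend k \<mu> (Alpha n))" using \<zeta> ext pre_trans by blast
  qed
  then have "prefixes_of k (extend k \<mu> (Alpha n)) = y"
    using y(1) prefixes_of_Lam_star[OF ext(1)] by (auto simp: Lam_max_def)
  then show False using ys(3)[OF \<alpha>] ext(1) pre_refl by blast
qed

section \<open>Invariant measures\<close>

lemma bdry_at_sub: "v \<ge> 1 \<Longrightarrow> bdry_at k v \<subseteq> Z k (idm k v)"
  by (simp add: bdry_at_eq)

text \<open>Range and source of an arrow, read off a representative. Constancy on classes of
  \<open>triple_equiv\<close> justifies the use of \<open>the_elem\<close> in \<open>grng\<close>
  and \<open>gsrc\<close>.\<close>

definition triple_ends :: "(nat \<Rightarrow> nat) \<Rightarrow> triple \<Rightarrow> mor set \<times> mor set" where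
  "triple_ends k = (\<lambda>(\<mu>, \<nu>, x). (shift k \<mu> x, shift k \<nu> x))"

lemma triple_step_ends:
  assumes "(s, t) \<in> triple_step k" shows "triple_ends k s = triple_ends k t"
proof -
  obtain \<mu> \<nu> \<eta> x where st: "s = (\<mu>, \<nu>, shift k \<eta> x)" "t = (mor_comp k \<mu> \<eta>, mor_comp k \<nu> \<eta>, x)"
    and h: "\<mu> \<in> Lam_at k 1" "\<nu> \<in> Lam_at k 1" "mor_src \<mu> = mor_src \<nu>"
      "\<eta> \<in> Lam_at k (mor_src \<mu>)" "x \<in> bdry_at k (mor_src \<eta>)"
    using assms unfolding triple_step_def by blast
  then have "\<mu> \<in> Lam k" "\<nu> \<in> Lam k" "\<eta> \<in> Lam k" "mor_rng \<eta> = mor_src \<mu>" by (auto simp: Lam_at_def)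
  moreover have "x \<in> Z k (idm k (mor_src \<eta>))"
    using bdry_at_sub[OF mor_src_pos] h(5) \<open>\<eta> \<in> Lam k\<close> by blast
  ultimately show ?thesis
    using h(3) by (simp add: st triple_ends_def shift_mor_comp)
qed

lemma triple_equiv_ends:
  assumes "(s, t) \<in> triple_equiv k" shows "triple_ends k s = triple_ends k t"
proof -
  have "(s, t) \<in> (triple_step k \<union> (triple_step k)\<inverse>)\<^sup>*" using assms by (simp add: triple_equiv_def)
  then show ?thesis
  proof (induction rule: rtrancl_induct)
    case (step t u)
    then show ?case using triple_step_ends[of t u k] triple_step_ends[of u t k] by auto
  qed simp
qed

lemma
  assumes "(\<mu>, \<nu>, x) \<in> triples k"
  shows gsrc_arrow_of: "gsrc (path_groupoid k) (arrow_of k \<mu> \<nu> x) = shift k \<nu> x"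
    and grng_arrow_of: "grng (path_groupoid k) (arrow_of k \<mu> \<nu> x) = shift k \<mu> x"
proof -
  have self: "(\<mu>, \<nu>, x) \<in> arrow_of k \<mu> \<nu> x"
    using assms by (simp add: arrow_of_def triple_equiv_def)
  have ends: "triple_ends k t = (shift k \<mu> x, shift k \<nu> x)" if "t \<in> arrow_of k \<mu> \<nu> x" for t
    using triple_equiv_ends[of "(\<mu>, \<nu>, x)" t k] that by (simp add: arrow_of_def triple_ends_def)
  have snd_eq: "(\<lambda>(\<mu>, \<nu>, x). shift k \<nu> x) = (\<lambda>t. snd (triple_ends k t))"
    and fst_eq: "(\<lambda>(\<mu>, \<nu>, x). shift k \<mu> x) = (\<lambda>t. fst (triple_ends k t))"
    by (auto simp: triple_ends_def)
  have "(\<lambda>t. snd (triple_ends k t)) ` arrow_of k \<mu> \<nu> x = {shift k \<nu> x}"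
    "(\<lambda>t. fst (triple_ends k t)) ` arrow_of k \<mu> \<nu> x = {shift k \<mu> x}"
    using self by (auto simp: ends image_iff intro!: bexI[OF _ self])
  then show "gsrc (path_groupoid k) (arrow_of k \<mu> \<nu> x) = shift k \<nu> x"
    "grng (path_groupoid k) (arrow_of k \<mu> \<nu> x) = shift k \<mu> x"
    by (simp_all add: path_groupoid_def snd_eq fst_eq)
qed

text \<open>Compactness of \<open>bdry_at k (mor_src \<mu>)\<close> admits \<open>E\<close> as a
  basic open set. Source and range are injective on \<open>E\<close> because \<open>unshift\<close>
  recovers \<open>x\<close> from \<open>shift k \<nu> x\<close> and from
  \<open>shift k \<mu> x\<close>.\<close>

lemma arrow_of_bisection:
  assumes "\<mu> \<in> Lam_at k 1" "\<nu> \<in> Lam_at k 1" "mor_src \<mu> = mor_src \<nu>"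
  defines "E \<equiv> arrow_of k \<mu> \<nu> ` bdry_at k (mor_src \<mu>)"
  shows "open_bisection (path_groupoid k) E"
    and "gsrc (path_groupoid k) ` E = bdry k \<inter> Z k \<nu>"
    and "grng (path_groupoid k) ` E = bdry k \<inter> Z k \<mu>"
proof -
  have L: "\<mu> \<in> Lam k" "\<nu> \<in> Lam k" using assms by (auto simp: Lam_at_def)
  have pos: "mor_src \<mu> \<ge> 1" using mor_src_pos L by blast
  have tr: "(\<mu>, \<nu>, x) \<in> triples k" if "x \<in> bdry_at k (mor_src \<mu>)" for x
    using that assms by (simp add: triples_def)
  have sub: "x \<in> Z k (idm k (mor_src \<mu>))" "x \<in> Z k (idm k (mor_src \<nu>))"
    if "x \<in> bdry_at k (mor_src \<mu>)" for x
    using that bdry_at_sub[OF pos] assms(3) by auto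
  have "openin (subtopology (Lam_star_top k) (bdry_at k (mor_src \<mu>))) (bdry_at k (mor_src \<mu>))"
    using openin_topspace topspace_subtopology_subset compactin_subset_topspace[OF compactin_bdry_at[OF pos]]
    by metis
  then have "openin (arrow_top k) E"
    unfolding arrow_top_def E_def using assms(1-3) compactin_bdry_at[OF pos]
    by (intro topology_generated_by_Basis) blast
  moreover have "x = y" if "x \<in> bdry_at k (mor_src \<mu>)" "y \<in> bdry_at k (mor_src \<mu>)"
    "shift k \<nu> x = shift k \<nu> y" for x y
    using unshift_shift[OF L(2)] sub that by metis
  then have "inj_on (gsrc (path_groupoid k)) E"
    unfolding E_def by (auto simp: inj_on_def gsrc_arrow_of tr)
  moreover have "x = y" if "x \<in> bdry_at k (mor_src \<mu>)" "y \<in> bdry_at k (mor_src \<mu>)"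
    "shift k \<mu> x = shift k \<mu> y" for x y
    using unshift_shift[OF L(1)] sub that by metis
  then have "inj_on (grng (path_groupoid k)) E"
    unfolding E_def by (auto simp: inj_on_def grng_arrow_of tr)
  ultimately show "open_bisection (path_groupoid k) E"
    unfolding open_bisection_def by (simp add: path_groupoid_def)
  have "gsrc (path_groupoid k) ` E = shift k \<nu> ` bdry_at k (mor_src \<nu>)"
    unfolding E_def image_image assms(3)[symmetric] by (intro image_cong refl gsrc_arrow_of tr)
  then show "gsrc (path_groupoid k) ` E = bdry k \<inter> Z k \<nu>" using shift_image_bdry[OF L(2)] by simp
  have "grng (path_groupoid k) ` E = shift k \<mu> ` bdry_at k (mor_src \<mu>)"
    unfolding E_def image_image by (intro image_cong refl grng_arrow_of tr)
  then show "grng (path_groupoid k) ` E = bdry k \<inter> Z k \<mu>" using shift_image_bdry[OF L(1)] by simp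
qed

section \<open>Cylinders in the boundary and the Borel sets of the unit space\<close>

definition cyl :: "(nat \<Rightarrow> nat) \<Rightarrow> mor \<Rightarrow> mor set set" where
  "cyl k \<mu> = bdry k \<inter> Z k \<mu>"

lemma invariant_measure_cyl:
  assumes "invariant_measure (path_groupoid k) M"
    and "\<mu> \<in> Lam_at k 1" "\<nu> \<in> Lam_at k 1" "mor_src \<mu> = mor_src \<nu>"
  shows "emeasure M (cyl k \<mu>) = emeasure M (cyl k \<nu>)"
  using assms(1) arrow_of_bisection[OF assms(2-4)] unfolding invariant_measure_def cyl_def by metis

lemma cyl_sub: "\<mu> \<in> Lam_at k 1 \<Longrightarrow> cyl k \<mu> \<subseteq> bdry_at k 1"
  using Z_mono[of "idm k 1" k \<mu>] by (auto simp: cyl_def bdry_at_eq Lam_at_def pre_idm_iff)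

lemma cyl_idm: "cyl k (idm k 1) = bdry_at k 1"
  by (simp add: cyl_def bdry_at_eq)

lemma cyl_Int:
  assumes "\<mu> \<in> Lam_at k 1"
  shows "cyl k \<mu> \<inter> cyl k \<nu> = {} \<or> (\<exists>\<tau>\<in>Lam_at k 1. cyl k \<mu> \<inter> cyl k \<nu> = cyl k \<tau>)"
proof (cases rule: Z_Int_cases[of k \<mu> \<nu>])
  case (2 \<tau>)
  then have "\<tau> \<in> Lam_at k 1" using assms pre_Lam2 pre_rng by (force simp: Lam_at_def)
  then show ?thesis using 2 by (auto simp: cyl_def)
qed (auto simp: cyl_def)

lemma topspace_unit_space: "topspace (unit_space k) = bdry_at k 1"
  unfolding unit_space_def using bdry_sub by (auto simp: bdry_at_def)

lemma openin_cyl: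
  assumes "\<mu> \<in> Lam_at k 1" shows "openin (unit_space k) (cyl k \<mu>)"
proof -
  have "cyl k \<mu> = Z k \<mu> \<inter> bdry_at k 1"
    using cyl_sub[OF assms] by (auto simp: cyl_def bdry_at_def)
  then show ?thesis unfolding unit_space_def openin_subtopology using openin_Z by blast
qed

text \<open>A base set is given by a morphism and a finite set of morphisms, and there are only
  countably many such pairs. So every open set is a countable union of base sets, each obtained from
  finitely many cylinders.\<close>

lemma sigma_sets_unit_space:
  "sigma_sets (bdry_at k 1) {U. openin (unit_space k) U} = sigma_sets (bdry_at k 1) (cyl k ` Lam_at k 1)"
    (is "_ = sigma_sets ?X ?E")
proof (rule sigma_sets_eqI)
  fix A assume "A \<in> {U. openin (unit_space k) U}"
  then obtain U where U: "openin (Lam_star_top k) U" "A = U \<inter> ?X"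
    by (auto simp: unit_space_def openin_subtopology)
  define I where "I = {p \<in> Lam k \<times> {F. finite F \<and> F \<subseteq> Lam k}. Z k (fst p) - (\<Union>\<mu>\<in>snd p. Z k \<mu>) \<subseteq> U}"
  have "countable (Lam k \<times> {F. finite F \<and> F \<subseteq> Lam k})"
    using countable_Lam countable_Collect_finite_subset by blast
  then have "countable I" unfolding I_def by (rule countable_subset[rotated]) blast
  have "U = (\<Union>p\<in>I. Z k (fst p) - (\<Union>\<mu>\<in>snd p. Z k \<mu>))"
  proof
    show "U \<subseteq> (\<Union>p\<in>I. Z k (fst p) - (\<Union>\<mu>\<in>snd p. Z k \<mu>))"
    proof
      fix x assume "x \<in> U"
      from Lam_star_top_base[OF U(1) this] obtain \<kappa> F where "\<kappa> \<in> Lam k" "finite F" "F \<subseteq> Lam k"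
        "x \<in> Z k \<kappa> - (\<Union>\<mu>\<in>F. Z k \<mu>)" "Z k \<kappa> - (\<Union>\<mu>\<in>F. Z k \<mu>) \<subseteq> U" by (elim exE conjE)
      then show "x \<in> (\<Union>p\<in>I. Z k (fst p) - (\<Union>\<mu>\<in>snd p. Z k \<mu>))"
        by (intro UN_I[of "(\<kappa>, F)"]) (auto simp: I_def)
    qed
  qed (auto simp: I_def)
  then have A: "A = (\<Union>p\<in>I. ?X \<inter> Z k (fst p) - (\<Union>\<mu>\<in>snd p. ?X \<inter> Z k \<mu>))"
    using U(2) by auto
  have E: "?E \<subseteq> Pow ?X" using cyl_sub by blast
  interpret sigma_algebra ?X "sigma_sets ?X ?E" by (rule sigma_algebra_sigma_sets[OF E])
  \<comment> \<open>Morphisms of other ranges may occur in the base sets; their trace on the unit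
    space is empty.\<close>
  have "?X \<inter> Z k \<kappa> \<in> sigma_sets ?X ?E" if "\<kappa> \<in> Lam k" for \<kappa>
  proof (cases "mor_rng \<kappa> = 1")
    case True
    then have "\<kappa> \<in> Lam_at k 1" using that by (simp add: Lam_at_def)
    moreover from cyl_sub[OF this] have "?X \<inter> Z k \<kappa> = cyl k \<kappa>" by (auto simp: cyl_def bdry_at_def)
    ultimately show ?thesis by auto
  next
    case False
    then have "?X \<inter> Z k \<kappa> = {}" using Z_idm_iff[of _ k \<kappa> 1] by (auto simp: bdry_at_eq Z_iff)
    then show ?thesis by (simp add: sigma_sets.Empty)
  qed
  moreover from this have "(\<Union>\<mu>\<in>F. ?X \<inter> Z k \<mu>) \<in> sigma_sets ?X ?E" if "finite F" "F \<subseteq> Lam k" for F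
    using that by (intro finite_UN) auto
  ultimately have "?X \<inter> Z k (fst p) - (\<Union>\<mu>\<in>snd p. ?X \<inter> Z k \<mu>) \<in> sigma_sets ?X ?E" if "p \<in> I" for p
    using that by (intro Diff) (auto simp del: Int_UN_distrib simp: I_def)
  then show "A \<in> sigma_sets ?X ?E"
    unfolding A using \<open>countable I\<close> by (intro countable_UN'')
qed (auto simp: openin_cyl)

text \<open>A reference morphism with range 1 for each source: \<open>Alpha\<close> edges exist at
  every object, even where \<open>k\<close> vanishes. With \<open>n\<close> edges the source is
  \<open>Suc n\<close>.\<close>

primrec alpha_path :: "(nat \<Rightarrow> nat) \<Rightarrow> nat \<Rightarrow> mor" where
  "alpha_path k 0 = idm k 1"
| "alpha_path k (Suc n) = extend k (alpha_path k n) (Alpha (Suc n))"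

lemma extend_Lam_at:
  assumes "\<mu> \<in> Lam_at k v" "e \<in> edges k" "edge_rng e = mor_src \<mu>"
  shows "extend k \<mu> e \<in> Lam_at k v" "mor_src (extend k \<mu> e) = Suc (mor_src \<mu>)"
  using assms by (auto simp: Lam_at_def edge_src_def)

lemma alpha_path_Lam_at: "alpha_path k n \<in> Lam_at k 1 \<and> mor_src (alpha_path k n) = Suc n"
proof (induction n)
  case 0
  then show ?case by (simp add: Lam_at_def)
next
  case (Suc n)
  then show ?case using extend_Lam_at[of "alpha_path k n" k 1 "Alpha (Suc n)"] by simp
qed

lemma cyl_extend_sub:
  assumes "\<mu> \<in> Lam k" "e \<in> edges k" "edge_rng e = mor_src \<mu>"
  shows "cyl k (extend k \<mu> e) \<subseteq> cyl k \<mu>"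
  using Z_mono[OF pre_mor_comp[OF assms(1) edgem_simps(1)[OF assms(2)]]] assms by (auto simp: cyl_def)

lemma cyl_extend_disjoint:
  assumes "\<mu> \<in> Lam k" "e \<in> edges k" "edge_rng e = mor_src \<mu>" "f \<in> edges k" "edge_rng f = mor_src \<mu>"
    and "e \<noteq> f" "{e, f} \<noteq> {Alpha (mor_src \<mu>), Beta (mor_src \<mu>)}"
  shows "cyl k (extend k \<mu> e) \<inter> cyl k (extend k \<mu> f) = {}"
  using pre_extend_distinct(1)[OF assms(1-5) _ _ assms(6)] assms(7)
  by (auto simp: cyl_def Z_iff elim!: Lam_star_dir)

text \<open>One inclusion reads the product in both orders, as \<open>Alpha\<close> then
  \<open>Beta\<close> and as \<open>Beta\<close> then \<open>Alpha\<close>. For the other, a common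
  extension supplied by directedness must extend this product.\<close>

lemma cyl_Alpha_Int_Beta:
  assumes "\<mu> \<in> Lam k" "mor_src \<mu> = n"
  shows "cyl k (extend k \<mu> (Alpha n)) \<inter> cyl k (extend k \<mu> (Beta n)) =
    cyl k (extend k (extend k \<mu> (Alpha n)) (Beta (Suc n)))"
proof
  have n: "n \<ge> 1" using assms mor_src_pos by blast
  have e: "extend k \<mu> (Alpha n) \<in> Lam k" "extend k \<mu> (Beta n) \<in> Lam k"
    "mor_src (extend k \<mu> (Alpha n)) = Suc n" "mor_src (extend k \<mu> (Beta n)) = Suc n"
    using assms n by simp_all
  show "cyl k (extend k (extend k \<mu> (Alpha n)) (Beta (Suc n)))
      \<subseteq> cyl k (extend k \<mu> (Alpha n)) \<inter> cyl k (extend k \<mu> (Beta n))"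
    using cyl_extend_sub[OF e(1), of "Beta (Suc n)"] cyl_extend_sub[OF e(2), of "Alpha (Suc n)"]
      extend_Alpha_Beta[OF assms] e(3,4) by simp
  show "cyl k (extend k \<mu> (Alpha n)) \<inter> cyl k (extend k \<mu> (Beta n))
      \<subseteq> cyl k (extend k (extend k \<mu> (Alpha n)) (Beta (Suc n)))"
  proof
    fix x assume "x \<in> cyl k (extend k \<mu> (Alpha n)) \<inter> cyl k (extend k \<mu> (Beta n))"
    then have x: "x \<in> bdry k" "x \<in> Lam_star k" "extend k \<mu> (Alpha n) \<in> x" "extend k \<mu> (Beta n) \<in> x"
      by (auto simp: cyl_def Z_iff)
    then obtain \<zeta> where \<zeta>: "\<zeta> \<in> x" "pre k (extend k \<mu> (Alpha n)) \<zeta>" "pre k (extend k \<mu> (Beta n)) \<zeta>"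
      by (blast elim: Lam_star_dir)
    then have "pre k (extend k (extend k \<mu> (Alpha n)) (Beta (Suc n))) \<zeta>"
      using pre_extend_distinct(2)[of \<mu> k "Alpha n" "Beta n" \<zeta>] assms n by simp
    then show "x \<in> cyl k (extend k (extend k \<mu> (Alpha n)) (Beta (Suc n)))"
      using x \<zeta>(1) Lam_star_her by (auto simp: cyl_def Z_iff)
  qed
qed

text \<open>Membership in the boundary is essential: \<open>prefixes_of k \<mu>\<close> lies in
  \<open>Z k \<mu>\<close> but contains no one-edge extension of \<mu>. For boundary points
  \<open>bdry_extend\<close> provides the edge.\<close>

lemma cyl_decomp:
  assumes "\<mu> \<in> Lam k" "mor_src \<mu> = n"
  shows "cyl k \<mu> = cyl k (extend k \<mu> (Alpha n)) \<union> cyl k (extend k \<mu> (Beta n))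
      \<union> (\<Union>j\<in>{1..k n}. cyl k (extend k \<mu> (Gamma n j)))"
proof
  have n: "n \<ge> 1" using assms mor_src_pos by blast
  show "cyl k \<mu> \<subseteq> cyl k (extend k \<mu> (Alpha n)) \<union> cyl k (extend k \<mu> (Beta n))
      \<union> (\<Union>j\<in>{1..k n}. cyl k (extend k \<mu> (Gamma n j)))"
  proof
    fix x assume "x \<in> cyl k \<mu>"
    then have x: "x \<in> bdry k" "\<mu> \<in> x" "x \<in> Lam_star k" by (auto simp: cyl_def Z_iff)
    then obtain e where e: "e \<in> edges k" "edge_rng e = n" "extend k \<mu> e \<in> x"
      using bdry_extend assms by blast
    then have "x \<in> cyl k (extend k \<mu> e)" using x by (simp add: cyl_def Z_iff)
    with e(1,2) show "x \<in> cyl k (extend k \<mu> (Alpha n)) \<union> cyl k (extend k \<mu> (Beta n))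
      \<union> (\<Union>j\<in>{1..k n}. cyl k (extend k \<mu> (Gamma n j)))"
      by (cases e) auto
  qed
  have "cyl k (extend k \<mu> (Alpha n)) \<subseteq> cyl k \<mu>" "cyl k (extend k \<mu> (Beta n)) \<subseteq> cyl k \<mu>"
    using cyl_extend_sub[OF assms(1)] assms(2) n by auto
  moreover have "cyl k (extend k \<mu> (Gamma n j)) \<subseteq> cyl k \<mu>" if "j \<in> {1..k n}" for j
    using cyl_extend_sub[OF assms(1), of "Gamma n j"] assms(2) n that by auto
  ultimately show "cyl k (extend k \<mu> (Alpha n)) \<union> cyl k (extend k \<mu> (Beta n))
      \<union> (\<Union>j\<in>{1..k n}. cyl k (extend k \<mu> (Gamma n j))) \<subseteq> cyl k \<mu>"
    by blast
qed

section \<open>Masses of cylinders and the recurrence\<close>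

lemma
  assumes "invariant_borel_prob (path_groupoid k) M"
  shows inv_prob_space: "prob_space M"
    and inv_measure: "invariant_measure (path_groupoid k) M"
    and space_inv: "space M = bdry_at k 1"
    and sets_inv: "sets M = sigma_sets (bdry_at k 1) (cyl k ` Lam_at k 1)"
  using assms sigma_sets_unit_space[of k] topspace_unit_space[of k]
  unfolding invariant_borel_prob_def borel_measure_on_def
  by (auto simp: path_groupoid_def)

lemma cyl_in_sets:
  "invariant_borel_prob (path_groupoid k) M \<Longrightarrow> \<mu> \<in> Lam_at k 1 \<Longrightarrow> cyl k \<mu> \<in> sets M"
  by (auto simp: sets_inv)

text \<open>The mass m_{n+1}, with index shifted because \<open>alpha_path k n\<close> has source
  \<open>Suc n\<close>. For invariant \<open>M\<close>, \<open>measure_cyl\<close> shows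
  independence of the chosen path.\<close>

definition level_measure :: "(nat \<Rightarrow> nat) \<Rightarrow> mor set measure \<Rightarrow> nat \<Rightarrow> real" where
  "level_measure k M n = measure M (cyl k (alpha_path k n))"

lemma measure_cyl:
  assumes "invariant_borel_prob (path_groupoid k) M" "\<mu> \<in> Lam_at k 1" "mor_src \<mu> = Suc n"
  shows "measure M (cyl k \<mu>) = level_measure k M n"
  using invariant_measure_cyl[OF inv_measure[OF assms(1)] assms(2), of "alpha_path k n"]
    alpha_path_Lam_at[of k n] assms(3)
  by (simp add: level_measure_def measure_def)

lemma level_measure_0:
  assumes "invariant_borel_prob (path_groupoid k) M"
  shows "level_measure k M 0 = 1"
  using prob_space.prob_space[OF inv_prob_space[OF assms]] space_inv[OF assms]
  by (simp add: level_measure_def cyl_idm del: One_nat_def)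

text \<open>Inclusion-exclusion over the one-edge cylinders: all pairs are disjoint except
  \<open>Alpha\<close> with \<open>Beta\<close>, whose intersection is a cylinder two levels down.
  Solving for this overlap term gives a forward recurrence.\<close>

lemma level_measure_rec:
  assumes inv: "invariant_borel_prob (path_groupoid k) M"
  shows "level_measure k M (Suc (Suc n)) =
    (2 + real (k (Suc n))) * level_measure k M (Suc n) - level_measure k M n"
proof -
  interpret prob_space M by (rule inv_prob_space[OF inv])
  define \<mu> where "\<mu> = alpha_path k n"
  have \<mu>: "\<mu> \<in> Lam_at k 1" "\<mu> \<in> Lam k" "mor_src \<mu> = Suc n"
    using alpha_path_Lam_at[of k n] by (auto simp: \<mu>_def Lam_at_def)
  let ?A = "cyl k (extend k \<mu> (Alpha (Suc n)))"
  let ?B = "cyl k (extend k \<mu> (Beta (Suc n)))"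
  let ?G = "\<lambda>j. cyl k (extend k \<mu> (Gamma (Suc n) j))"
  have ext: "extend k \<mu> e \<in> Lam_at k 1" "mor_src (extend k \<mu> e) = Suc (Suc n)"
    if "e \<in> edges k" "edge_rng e = Suc n" for e
    using extend_Lam_at[OF \<mu>(1) that(1)] that(2) \<mu>(3) by auto
  have m: "cyl k (extend k \<mu> e) \<in> sets M" "measure M (cyl k (extend k \<mu> e)) = level_measure k M (Suc n)"
    if "e \<in> edges k" "edge_rng e = Suc n" for e
    using ext[OF that] cyl_in_sets[OF inv] measure_cyl[OF inv] by auto
  have mAB: "measure M (?A \<inter> ?B) = level_measure k M (Suc (Suc n))"
    unfolding cyl_Alpha_Int_Beta[OF \<mu>(2,3)]
    using ext[of "Alpha (Suc n)"] extend_Lam_at[of "extend k \<mu> (Alpha (Suc n))" k 1 "Beta (Suc (Suc n))"]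
    by (intro measure_cyl[OF inv]) auto
  have disj: "cyl k (extend k \<mu> e) \<inter> ?G j = {}"
    if "j \<in> {1..k (Suc n)}" "e \<in> edges k" "edge_rng e = Suc n" "e \<noteq> Gamma (Suc n) j" for e j
    using that \<mu>(3) by (intro cyl_extend_disjoint[OF \<mu>(2)]) (auto simp: doubleton_eq_iff)
  have "level_measure k M n = measure M ((?A \<union> ?B) \<union> (\<Union>j\<in>{1..k (Suc n)}. ?G j))"
    unfolding level_measure_def \<mu>_def[symmetric] cyl_decomp[OF \<mu>(2,3), symmetric] ..
  also have "\<dots> = measure M (?A \<union> ?B) + measure M (\<Union>j\<in>{1..k (Suc n)}. ?G j)"
  proof (rule finite_measure_Union)
    show "?A \<union> ?B \<in> sets M" using m by auto
    show "(\<Union>j\<in>{1..k (Suc n)}. ?G j) \<in> sets M" by (intro sets.finite_UN) (use m in auto)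
    show "(?A \<union> ?B) \<inter> (\<Union>j\<in>{1..k (Suc n)}. ?G j) = {}"
    proof -
      have "?A \<inter> ?G j = {}" "?B \<inter> ?G j = {}" if "j \<in> {1..k (Suc n)}" for j
        using disj[OF that] by simp_all
      then show ?thesis by blast
    qed
  qed
  also have "measure M (?A \<union> ?B) = measure M ?A + measure M ?B - measure M (?A \<inter> ?B)"
    using m by (intro measure_Un3) (auto simp: fmeasurable_eq_sets)
  also have "measure M (\<Union>j\<in>{1..k (Suc n)}. ?G j) = (\<Sum>j\<in>{1..k (Suc n)}. measure M (?G j))"
  proof (rule finite_measure_finite_Union)
    show "disjoint_family_on ?G {1..k (Suc n)}"
      unfolding disjoint_family_on_def using disj by auto
  qed (use m in auto)
  finally show ?thesis using m mAB by (simp add: algebra_simps)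
qed

text \<open>For a solution f the increments satisfy f_{n+2} - f_{n+1} = (f_{n+1} - f_n) + c_n
  f_{n+1}, so they do not decrease as long as f is nonnegative. A positive first value thus forces
  growth by at least that value in each step.\<close>

lemma bounded_recurrence_zero:
  fixes e :: "nat \<Rightarrow> real"
  assumes rec: "\<And>n. e (Suc (Suc n)) = (2 + c n) * e (Suc n) - e n" and c: "\<And>n. c n \<ge> 0"
    and bound: "\<And>n. \<bar>e n\<bar> \<le> b" and "e 0 = 0"
  shows "e n = 0"
proof -
  \<comment> \<open>Stated for general \<open>f\<close> to be applied to \<open>e\<close> and to
    \<open>- e\<close>, which excludes both signs of \<open>e 1\<close>.\<close>
  have *: "f 1 \<le> 0" if f: "\<And>n. f (Suc (Suc n)) = (2 + c n) * f (Suc n) - f n" "f 0 = 0"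
    and b: "\<And>n. \<bar>f n\<bar> \<le> b" for f :: "nat \<Rightarrow> real"
  proof (rule ccontr)
    assume "\<not> f 1 \<le> 0"
    then have t: "f 1 > 0" by simp
    \<comment> \<open>Nonnegativity is carried along because it fixes the sign of
      \<open>c n * f (Suc n)\<close>.\<close>
    have step: "f n \<ge> 0 \<and> f (Suc n) \<ge> f n + f 1" for n
    proof (induction n)
      case (Suc n)
      then have "c n * f (Suc n) \<ge> 0" using t c by (intro mult_nonneg_nonneg) auto
      then show ?case using Suc t f(1)[of n] by (auto simp: algebra_simps)
    qed (simp add: f)
    have "f n \<ge> real n * f 1" for n
    proof (induction n)
      case (Suc n)
      then show ?case using step[of n] by (simp add: algebra_simps)
    qed (simp add: f)
    moreover obtain n where "b < real n * f 1" using reals_Archimedean3[OF t] by blast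
    ultimately show False using b[of n] by (meson abs_le_D1 linorder_not_less order_trans)
  qed
  have "e 1 \<le> 0" using rec bound \<open>e 0 = 0\<close> by (intro *) auto
  moreover have "- e 1 \<le> 0" using rec bound \<open>e 0 = 0\<close>
    by (intro *[of "\<lambda>n. - e n"]) (auto simp: algebra_simps)
  ultimately have "e (Suc 0) = 0" by simp
  then have "e n = 0 \<and> e (Suc n) = 0" using \<open>e 0 = 0\<close> by (induction n) (auto simp: rec)
  then show ?thesis ..
qed

lemma level_measure_unique:
  assumes "invariant_borel_prob (path_groupoid k) M" "invariant_borel_prob (path_groupoid k) N"
  shows "level_measure k M n = level_measure k N n"
proof -
  have "level_measure k M n - level_measure k N n = 0"
  proof (rule bounded_recurrence_zero[where b = 1 and c = "\<lambda>n. real (k (Suc n))"])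
    fix n
    have "0 \<le> level_measure k M n" "level_measure k M n \<le> 1" "0 \<le> level_measure k N n" "level_measure k N n \<le> 1"
      using assms[THEN inv_prob_space] by (auto simp: level_measure_def prob_space.prob_le_1)
    then show "\<bar>level_measure k M n - level_measure k N n\<bar> \<le> 1" by linarith
  qed (simp_all add: level_measure_rec[OF assms(1)] level_measure_rec[OF assms(2)]
      level_measure_0[OF assms(1)] level_measure_0[OF assms(2)] algebra_simps)
  then show ?thesis by simp
qed

lemma invariant_borel_prob_unique:
  assumes M: "invariant_borel_prob (path_groupoid k) M" and N: "invariant_borel_prob (path_groupoid k) N"
  shows "M = N"
proof (rule measure_eqI_generator_eq)
  \<comment> \<open>Cylinders may be disjoint, so the empty set is added to obtain closure under
    intersection.\<close>
  let ?E = "insert {} (cyl k ` Lam_at k 1)"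
  interpret M: prob_space M by (rule inv_prob_space[OF M])
  interpret N: prob_space N by (rule inv_prob_space[OF N])
  have id: "idm k 1 \<in> Lam_at k 1" by (simp add: Lam_at_def)
  show "Int_stable ?E"
    unfolding Int_stable_def
  proof (intro ballI)
    fix A B assume "A \<in> ?E" "B \<in> ?E"
    then consider "A \<inter> B = {}" | \<mu> \<nu> where "\<mu> \<in> Lam_at k 1" "A = cyl k \<mu>" "B = cyl k \<nu>" by blast
    then show "A \<inter> B \<in> ?E" using cyl_Int by cases blast+
  qed
  show "?E \<subseteq> Pow (bdry_at k 1)" using cyl_sub by blast
  show "emeasure M A = emeasure N A" if "A \<in> ?E" for A
  proof (cases "A = {}")
    case False
    with that obtain \<mu> where \<mu>: "\<mu> \<in> Lam_at k 1" "A = cyl k \<mu>" by blast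
    then have "mor_src \<mu> \<ge> 1" using mor_src_pos by (auto simp: Lam_at_def)
    then obtain n where "mor_src \<mu> = Suc n" by (cases "mor_src \<mu>") auto
    then have "measure M A = measure N A"
      using \<mu> measure_cyl M N level_measure_unique by metis
    then show ?thesis by (simp add: M.emeasure_eq_measure N.emeasure_eq_measure)
  qed simp
  have "sigma_sets (bdry_at k 1) (cyl k ` Lam_at k 1) = sigma_sets (bdry_at k 1) ?E"
    by (rule sigma_sets_eqI) (auto intro: sigma_sets.Empty)
  then show "sets M = sigma_sets (bdry_at k 1) ?E" "sets N = sigma_sets (bdry_at k 1) ?E"
    using sets_inv[OF M] sets_inv[OF N] by auto
  \<comment> \<open>The cylinder of the identity is the whole unit space, so a constant sequence
    serves as the exhausting one.\<close>
  show "range (\<lambda>i::nat. cyl k (idm k 1)) \<subseteq> ?E" using id by auto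
  show "(\<Union>i::nat. cyl k (idm k 1)) = bdry_at k 1" by (simp only: cyl_idm) simp
  show "emeasure M (cyl k (idm k 1)) \<noteq> \<infinity>" by simp
qed

theorem theorem6p6:
  fixes \<sigma> :: real and c :: "nat \<Rightarrow> int" and k1 :: nat
  assumes "\<sigma> > 0" and "\<sigma> \<notin> \<rat>"
    and "simple_cf_expansion \<sigma> c"
    and "\<exists>M. invariant_borel_prob (path_groupoid (mult_seq k1 c)) M"
  shows "\<exists>!M. invariant_borel_prob (path_groupoid (mult_seq k1 c)) M"
  using assms(4) invariant_borel_prob_unique by blast

end
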